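(* Let $(M,g)$ be either a Riemannian manifold of odd dimension $m\ge3$, or a Lorentzian manifold (signature $(1,q)$) of dimension $m\ge3$. Then $(M,g)$ is conformally spacelike Jordan Osserman if and only if $(M,g)$ is conformally flat, i.e. its Weyl conformal curvature tensor vanishes identically.
   Context: For a pseudo-Riemannian manifold $(M,g)$ of dimension $m\ge3$ with Riemann curvature tensor $R$ (as a 4-tensor), Ricci tensor $\rho(x,y)=\sum_{ij}g^{ij}R(x,e_i,e_j,y)$ and scalar curvature $\tau=\sum_{ij}g^{ij}\rho(e_i,e_j)$, the Weyl conformal curvature tensor is $W(x,y,z,w)=R(x,y,z,w)-\frac1{m-2}\{\rho(x,w)g(y,z)+g(x,w)\rho(y,z)\}+\frac1{m-2}\{\rho(x,z)g(y,w)+g(x,z)\rho(y,w)\}+\frac{\tau}{(m-1)(m-2)}\{g(x,w)g(y,z)-g(x,z)g(y,w)\}$. The Jacobi operator $J_W(x)$ on $T_PM$ is the self-adjoint endomorphism with $g(J_W(x)y,z)=W(y,x,x,z)$. $(M,g)$ is conformally spacelike Jordan Osserman if for every $P\in M$ the Jordan normal form of $J_{W_P}(x)$ is the same for all $x\in T_PM$ with $g_P(x,x)=1$ (it may depend on $P$). *)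

theory Defs
  imports "Jordan_Normal_Form.Jordan_Normal_Form" "Jordan_Normal_Form.Gauss_Jordan_Elimination"
begin

text \<open>Pointwise (tangent-space) data of a pseudo-Riemannian manifold, in components with
respect to an arbitrary basis e_0,...,e_(m-1) of the tangent space:
the metric is an m x m real matrix G (G $$ (i,j) = g(e_i,e_j)),
the Riemann 4-tensor is given by its components R a b c d = R(e_a,e_b,e_c,e_d).\<close>

definition ginv :: "real mat \<Rightarrow> real mat" where
  "ginv G = the (mat_inverse G)"

definition bilin :: "real mat \<Rightarrow> real vec \<Rightarrow> real vec \<Rightarrow> real" where
  "bilin G x y = (\<Sum>i<dim_row G. \<Sum>j<dim_col G. x $ i * G $$ (i,j) * y $ j)"

definition riemannian_metric :: "nat \<Rightarrow> real mat \<Rightarrow> bool" where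
  "riemannian_metric m G \<longleftrightarrow> G \<in> carrier_mat m m \<and> G\<^sup>T = G \<and>
     (\<exists>P \<in> carrier_mat m m. det P \<noteq> 0 \<and> P\<^sup>T * G * P = 1\<^sub>m m)"

definition lorentz_diag :: "nat \<Rightarrow> real mat" where
  "lorentz_diag m = mat m m (\<lambda>(i,j). if i = j then (if i = 0 then -1 else 1) else 0)"

definition lorentzian_metric :: "nat \<Rightarrow> real mat \<Rightarrow> bool" where
  "lorentzian_metric m G \<longleftrightarrow> G \<in> carrier_mat m m \<and> G\<^sup>T = G \<and>
     (\<exists>P \<in> carrier_mat m m. det P \<noteq> 0 \<and> P\<^sup>T * G * P = lorentz_diag m)"

definition alg_curv_tensor :: "nat \<Rightarrow> (nat \<Rightarrow> nat \<Rightarrow> nat \<Rightarrow> nat \<Rightarrow> real) \<Rightarrow> bool" where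
  "alg_curv_tensor m R \<longleftrightarrow> (\<forall>a<m. \<forall>b<m. \<forall>c<m. \<forall>d<m.
      R a b c d = - R b a c d \<and> R a b c d = R c d a b \<and>
      R a b c d + R b c a d + R c a b d = 0)"

definition ricci :: "nat \<Rightarrow> real mat \<Rightarrow> (nat \<Rightarrow> nat \<Rightarrow> nat \<Rightarrow> nat \<Rightarrow> real) \<Rightarrow> nat \<Rightarrow> nat \<Rightarrow> real" where
  "ricci m G R a b = (\<Sum>i<m. \<Sum>j<m. ginv G $$ (i,j) * R a i j b)"

definition scal :: "nat \<Rightarrow> real mat \<Rightarrow> (nat \<Rightarrow> nat \<Rightarrow> nat \<Rightarrow> nat \<Rightarrow> real) \<Rightarrow> real" where
  "scal m G R = (\<Sum>i<m. \<Sum>j<m. ginv G $$ (i,j) * ricci m G R i j)"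

definition weyl :: "nat \<Rightarrow> real mat \<Rightarrow> (nat \<Rightarrow> nat \<Rightarrow> nat \<Rightarrow> nat \<Rightarrow> real) \<Rightarrow> nat \<Rightarrow> nat \<Rightarrow> nat \<Rightarrow> nat \<Rightarrow> real" where
  "weyl m G R x y z w =
     R x y z w
     - 1 / (real m - 2) * (ricci m G R x w * G $$ (y,z) + G $$ (x,w) * ricci m G R y z)
     + 1 / (real m - 2) * (ricci m G R x z * G $$ (y,w) + G $$ (x,z) * ricci m G R y w)
     + scal m G R / ((real m - 1) * (real m - 2)) * (G $$ (x,w) * G $$ (y,z) - G $$ (x,z) * G $$ (y,w))"

text \<open>Matrix of the Jacobi operator J_W(x): g(J_W(x) y, z) = W(y,x,x,z).
Entry (k,b) is the k-th component of J_W(x) e_b.\<close>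
definition jacobi_W :: "nat \<Rightarrow> real mat \<Rightarrow> (nat \<Rightarrow> nat \<Rightarrow> nat \<Rightarrow> nat \<Rightarrow> real) \<Rightarrow> real vec \<Rightarrow> real mat" where
  "jacobi_W m G R x = mat m m (\<lambda>(k,b).
     \<Sum>c<m. (\<Sum>a<m. \<Sum>d<m. x $ a * x $ d * weyl m G R b a d c) * ginv G $$ (c,k))"

definition conf_spacelike_jordan_osserman_at :: "nat \<Rightarrow> real mat \<Rightarrow> (nat \<Rightarrow> nat \<Rightarrow> nat \<Rightarrow> nat \<Rightarrow> real) \<Rightarrow> bool" where
  "conf_spacelike_jordan_osserman_at m G R \<longleftrightarrow>
     (\<exists>n_as. \<forall>x \<in> carrier_vec m. bilin G x x = 1 \<longrightarrow>
        jordan_nf (map_mat complex_of_real (jacobi_W m G R x)) n_as)"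

definition weyl_vanishes_at :: "nat \<Rightarrow> real mat \<Rightarrow> (nat \<Rightarrow> nat \<Rightarrow> nat \<Rightarrow> nat \<Rightarrow> real) \<Rightarrow> bool" where
  "weyl_vanishes_at m G R \<longleftrightarrow> (\<forall>a<m. \<forall>b<m. \<forall>c<m. \<forall>d<m. weyl m G R a b c d = 0)"

end

theory Submission
  imports "HOL-Homology.Homology" Defs
begin

text \<open>
  The statement is pointwise; in a pseudo-orthonormal frame the Weyl tensor is an algebraic curvature
  tensor all of whose traces vanish, and Jacobi operators are conjugated by the change of frame.

  \<^emph>\<open>Riemannian case, odd \<open>m\<close>.\<close> The Jordan form annihilates all Jacobi operators \<open>J(x)\<close>, \<open>|x| = 1\<close>, by one
  polynomial; as \<open>J(x)\<close> is symmetric, this polynomial may be taken with simple real roots, so the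
  eigenspace projections depend continuously on \<open>x\<close>. If \<open>J(x\<^sub>0) \<noteq> 0\<close>, tracelessness gives two distinct
  nonzero eigenvalues \<open>\<lambda>\<close>, \<open>\<mu>\<close>. Transporting a \<open>\<lambda>\<close>-eigenvector away from \<open>x\<^sub>0\<close> and a \<open>\<mu>\<close>-eigenvector away
  from \<open>-x\<^sub>0\<close> yields two fields, each defined and nonvanishing on more than a hemisphere, that are
  orthogonal to each other and, because \<open>J(x) x = 0\<close>, tangent to the sphere. Glued by cut-off functions
  they form a nowhere vanishing tangent field on an even-dimensional sphere, contradicting the
  hairy ball theorem.

  \<^emph>\<open>Lorentzian case.\<close> The trace of \<open>J(x)\<^sup>2\<close> is a constant multiple of \<open>g(x,x)\<^sup>2\<close> on spacelike vectors, hence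
  vanishes on null vectors \<open>n\<close> by continuity. There it is the squared norm of \<open>W(\<cdot>,n,n,\<cdot>)\<close> on a spacelike
  complement of \<open>n\<close> in \<open>n\<^sup>\<bottom>\<close>, and together with tracelessness this forces \<open>W = 0\<close>.
\<close>

unbundle no vec_syntax


section \<open>Degree theory on spheres and the hairy ball theorem\<close>

definition unit_sphere :: "nat \<Rightarrow> (nat \<Rightarrow> real) set" where
  "unit_sphere p = {x. (\<Sum>i\<le>p. (x i)\<^sup>2) = 1 \<and> (\<forall>i>p. x i = 0)}"

lemma nsphere_eq_unit_sphere: "nsphere p = top_of_set (unit_sphere p)"
  by (simp add: nsphere unit_sphere_def euclidean_product_topology)

lemma continuous_map_nsphere_iff:
  "continuous_map (nsphere p) (nsphere p) f \<longleftrightarrow>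
     continuous_on (unit_sphere p) f \<and> f \<in> unit_sphere p \<rightarrow> unit_sphere p"
  by (simp add: nsphere_eq_unit_sphere)

lemma continuous_map_nsphere_swap:
  assumes "k \<le> p"
  shows "continuous_map (nsphere p) (nsphere p) (\<lambda>x i. x (Transposition.transpose 0 k i))"
proof -
  have "(\<Sum>i\<le>p. (x (Transposition.transpose 0 k i))\<^sup>2) = (\<Sum>i\<le>p. (x i)\<^sup>2)" for x :: "nat \<Rightarrow> real"
    by (rule sum.reindex_bij_witness[of _ "Transposition.transpose 0 k" "Transposition.transpose 0 k"])
       (use assms in \<open>auto simp: Transposition.transpose_def\<close>)
  moreover have "Transposition.transpose 0 k i = i" if "i > p" for i
    using that assms by (auto simp: Transposition.transpose_def)
  moreover have "continuous_on (unit_sphere p) (\<lambda>x i. x (Transposition.transpose 0 k i))"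
    by (intro continuous_on_coordinatewise_then_product continuous_on_subset[OF continuous_on_product_coordinates]) auto
  ultimately show ?thesis
    by (simp add: continuous_map_nsphere_iff unit_sphere_def Pi_iff)
qed

text \<open>The reflection in coordinate \<open>k\<close> is the reflection in coordinate 0
  conjugated by the swap of 0 and \<open>k\<close>. The swap is an involution, so its degree squares
  to 1 and the degree -1 carries over.\<close>

lemma Brouwer_degree2_reflection_at:
  assumes "k \<le> p"
  shows "Brouwer_degree2 p (\<lambda>x i. if i = k then - x i else x i) = -1"
proof -
  let ?s = "\<lambda>(x :: nat \<Rightarrow> real) i. x (Transposition.transpose 0 k i)"
  let ?r = "\<lambda>k (x :: nat \<Rightarrow> real) i. if i = k then - x i else x i"
  have s: "continuous_map (nsphere p) (nsphere p) ?s"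
    using assms by (rule continuous_map_nsphere_swap)
  have r: "continuous_map (nsphere p) (nsphere p) (?r k)" for k
    by (rule continuous_map_nsphere_reflection)
  have ss: "?s \<circ> ?s = id"
    by (simp add: fun_eq_iff)
  have conj: "?r k = ?s \<circ> ?r 0 \<circ> ?s"
    by (auto simp: fun_eq_iff Transposition.transpose_def)
  have "Brouwer_degree2 p ?s * Brouwer_degree2 p ?s = 1"
    using Brouwer_degree2_compose[OF s s] by (simp add: ss)
  then show ?thesis
    unfolding conj
    using Brouwer_degree2_compose[OF s continuous_map_compose[OF r s], of 0]
      Brouwer_degree2_compose[OF r s, of 0] Brouwer_degree2_reflection[of p]
    by (simp add: o_assoc)
qed

lemma Brouwer_degree2_antipodal:
  assumes "even p"
  shows "Brouwer_degree2 p (\<lambda>x i. if i \<le> p then - x i else x i) = -1"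
proof -
  \<comment> \<open>\<open>?a j\<close> negates the first \<open>j\<close> coordinates. One more
    reflection leads from \<open>?a j\<close> to \<open>?a (Suc j)\<close>, so the antipodal map,
    reached at \<open>j = p + 1\<close>, has degree \<open>(-1) ^ (p + 1)\<close>.\<close>
  let ?a = "\<lambda>j (x :: nat \<Rightarrow> real) i. if i < j then - x i else x i"
  have "continuous_map (nsphere p) (nsphere p) (?a j) \<and> Brouwer_degree2 p (?a j) = (-1) ^ j"
    if "j \<le> Suc p" for j
    using that
  proof (induction j)
    case 0
    have "?a 0 = id" by (simp add: fun_eq_iff)
    then show ?case by simp
  next
    case (Suc j)
    let ?r = "\<lambda>(x :: nat \<Rightarrow> real) i. if i = j then - x i else x i"
    have comp: "?a (Suc j) = ?r \<circ> ?a j"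
      by (auto simp: fun_eq_iff)
    have r: "continuous_map (nsphere p) (nsphere p) ?r"
      by (rule continuous_map_nsphere_reflection)
    have a: "continuous_map (nsphere p) (nsphere p) (?a j)"
      using Suc by simp
    have "Brouwer_degree2 p (?a (Suc j)) = (-1) ^ Suc j"
      unfolding comp Brouwer_degree2_compose[OF a r]
      using Suc Brouwer_degree2_reflection_at[of j p] by simp
    moreover have "continuous_map (nsphere p) (nsphere p) (?a (Suc j))"
      unfolding comp by (rule continuous_map_compose[OF a r])
    ultimately show ?case by simp
  qed
  from this[of "Suc p"] assms show ?thesis
    by (simp add: less_Suc_eq_le)
qed

text \<open>A field without zeros, normalised to \<open>w\<close>, moves every \<open>x\<close>
  along the half great circle \<open>cos (pi * t) * x + sin (pi * t) * w x\<close> to its antipode.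
  This homotopy joins the identity, of degree 1, to the antipodal map, which has degree -1 for even
  \<open>p\<close>.\<close>

theorem hairy_ball:
  assumes "even p" and cont: "continuous_on (unit_sphere p) v"
    and supp: "\<And>x i. x \<in> unit_sphere p \<Longrightarrow> i > p \<Longrightarrow> v x i = 0"
    and tangent: "\<And>x. x \<in> unit_sphere p \<Longrightarrow> (\<Sum>i\<le>p. v x i * x i) = 0"
  shows "\<exists>x\<in>unit_sphere p. \<forall>i. v x i = (0::real)"
proof (rule ccontr)
  assume neg: "\<not> ?thesis"
  have nz: "(\<Sum>i\<le>p. (v x i)\<^sup>2) > 0" if "x \<in> unit_sphere p" for x
  proof -
    from neg that have "\<not> (\<forall>i. v x i = 0)" by (simp only: bex_simps) simp
    then obtain i where i: "v x i \<noteq> 0" by blast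
    then have "i \<le> p" using supp[OF that] not_le by metis
    then show ?thesis using i by (intro sum_pos2[of _ i]) auto
  qed
  define w where "w = (\<lambda>x i. v x i / sqrt (\<Sum>j\<le>p. (v x j)\<^sup>2))"
  have w1: "(\<Sum>i\<le>p. (w x i)\<^sup>2) = 1" if "x \<in> unit_sphere p" for x
    using nz[OF that] by (simp add: w_def power_divide sum_nonneg flip: sum_divide_distrib)
  have wx: "(\<Sum>i\<le>p. w x i * x i) = 0" if "x \<in> unit_sphere p" for x
    using tangent[OF that] by (simp add: w_def flip: sum_divide_distrib)
  have vi: "continuous_on (unit_sphere p) (\<lambda>x. v x i)" for i
    using cont by (rule continuous_on_product_then_coordinatewise)
  have wi: "continuous_on (unit_sphere p) (\<lambda>x. w x i)" for i
    unfolding w_def using nz by (intro continuous_intros vi) force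
  define h where "h = (\<lambda>(t, x) i. cos (pi * t) * x i + sin (pi * t) * w x i)"
  have "continuous_on ({0..1} \<times> unit_sphere p) (\<lambda>z. w (snd z) i)" for i
    by (rule continuous_on_compose2[OF wi continuous_on_snd[OF continuous_on_id]]) auto
  moreover have "continuous_on ({0..1} \<times> unit_sphere p) (\<lambda>z. snd z i)" for i
    by (rule continuous_on_compose2[OF continuous_on_product_coordinates continuous_on_snd[OF continuous_on_id]]) auto
  ultimately have h: "continuous_on ({0..1} \<times> unit_sphere p) h"
    unfolding h_def case_prod_unfold
    by (intro continuous_on_coordinatewise_then_product continuous_intros)
  have "h (t, x) \<in> unit_sphere p" if x: "x \<in> unit_sphere p" for t x
  proof -
    have "(\<Sum>i\<le>p. (h (t, x) i)\<^sup>2) =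
        (cos (pi * t))\<^sup>2 * (\<Sum>i\<le>p. (x i)\<^sup>2) + (sin (pi * t))\<^sup>2 * (\<Sum>i\<le>p. (w x i)\<^sup>2)
        + 2 * cos (pi * t) * sin (pi * t) * (\<Sum>i\<le>p. w x i * x i)"
      unfolding sum_distrib_left sum.distrib[symmetric]
      by (intro sum.cong refl) (simp add: h_def power2_eq_square algebra_simps)
    also have "\<dots> = 1"
      using w1[OF x] wx[OF x] x by (simp add: unit_sphere_def)
    finally show ?thesis
      using x supp[OF x] by (auto simp: unit_sphere_def h_def w_def)
  qed
  then have hm: "continuous_map (prod_topology (top_of_set {0..1}) (nsphere p)) (nsphere p) h"
    unfolding nsphere_eq_unit_sphere prod_topology_subtopology using h
    by (auto simp: subtopology_subtopology euclidean_product_topology Times_Int_Times)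
  have "homotopic_with (\<lambda>x. True) (nsphere p) (nsphere p) id (\<lambda>x i. if i \<le> p then - x i else x i)"
  proof (subst homotopic_with, simp, intro exI[of _ h] conjI ballI)
    show "continuous_map (prod_topology (top_of_set {0..1}) (nsphere p)) (nsphere p) h"
      by (rule hm)
  qed (auto simp: h_def nsphere_eq_unit_sphere unit_sphere_def)
  from Brouwer_degree2_homotopic[OF this] Brouwer_degree2_antipodal[OF \<open>even p\<close>]
  show False by simp
qed

section \<open>Polynomials in a matrix, given by their lists of roots\<close>

definition mvec :: "nat \<Rightarrow> (nat \<Rightarrow> nat \<Rightarrow> 'a) \<Rightarrow> (nat \<Rightarrow> 'a) \<Rightarrow> nat \<Rightarrow> 'a::comm_ring_1" where
  "mvec m K u i = (if i < m then \<Sum>j<m. K i j * u j else 0)"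

text \<open>This is the product of the operators \<open>T - a\<close> over the list, the last entry
  acting first: a monic polynomial in \<open>T\<close> given by its roots with multiplicity.\<close>

definition shift_prod :: "((nat \<Rightarrow> 'a) \<Rightarrow> nat \<Rightarrow> 'a) \<Rightarrow> 'a list \<Rightarrow> (nat \<Rightarrow> 'a) \<Rightarrow> nat \<Rightarrow> 'a::comm_ring_1" where
  "shift_prod T as = foldr (\<lambda>a u i. T u i - a * u i) as"

text \<open>Vectors of length \<open>m\<close> are functions on the naturals vanishing from
  \<open>m\<close> on. Points of \<open>unit_sphere\<close> are encoded in the same way, so matrices
  act directly on the space where the hairy ball theorem lives.\<close>

definition supported :: "nat \<Rightarrow> (nat \<Rightarrow> 'a::zero) \<Rightarrow> bool" where
  "supported m v \<longleftrightarrow> (\<forall>i\<ge>m. v i = 0)"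

lemma shift_prod_Nil [simp]: "shift_prod T [] v = v"
  by (simp add: shift_prod_def)

lemma shift_prod_Cons [simp]:
  "shift_prod T (a # as) v = (\<lambda>i. T (shift_prod T as v) i - a * shift_prod T as v i)"
  by (simp add: shift_prod_def)

lemma shift_prod_append: "shift_prod T (as @ bs) v = shift_prod T as (shift_prod T bs v)"
  by (simp add: shift_prod_def)

lemma supported_mvec [simp]: "supported m (mvec m K v)"
  by (simp add: supported_def mvec_def)

lemma supported_shift_prod: "supported m v \<Longrightarrow> supported m (shift_prod (mvec m K) as v)"
  by (induction as) (auto simp: supported_def mvec_def)

lemma mvec_linear:
  "mvec m K (\<lambda>i. c * u i + d * v i) = (\<lambda>i. c * mvec m K u i + d * mvec m K v i)"
  by (auto simp: mvec_def fun_eq_iff sum_distrib_left simp flip: sum.distrib intro!: sum.cong)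
     (simp add: algebra_simps)

lemma mvec_diff_scale: "mvec m K (\<lambda>i. u i - a * v i) = (\<lambda>i. mvec m K u i - a * mvec m K v i)"
  using mvec_linear[of m K 1 u "- a" v] by simp

lemma mvec_scale: "mvec m K (\<lambda>i. a * v i) = (\<lambda>i. a * mvec m K v i)"
  using mvec_linear[of m K a v 0 v] by simp

lemma mvec_zero [simp]: "mvec m K (\<lambda>i. 0) = (\<lambda>i. 0)"
  by (auto simp: mvec_def fun_eq_iff)

lemma shift_prod_zero [simp]: "shift_prod (mvec m K) as (\<lambda>i. 0) = (\<lambda>i. 0)"
  by (induction as) auto

text \<open>Cayley-Hamilton for triangular matrices: the factor with the last diagonal entry acts
  first and pushes vectors supported below \<open>k + 1\<close> to vectors supported below
  \<open>k\<close>; after all factors nothing is left.\<close>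

lemma shift_prod_upper_triangular:
  assumes tri: "\<And>i j. j < i \<Longrightarrow> i < m \<Longrightarrow> K i j = 0" and "k \<le> m" and "supported k v"
  shows "shift_prod (mvec m K) (map (\<lambda>i. K i i) [0..<k]) v = (\<lambda>i. 0)"
  using assms(2,3)
proof (induction k arbitrary: v)
  case 0
  then show ?case by (simp add: supported_def fun_eq_iff)
next
  case (Suc k)
  let ?w = "\<lambda>i. mvec m K v i - K k k * v i"
  have zero: "K i j * v j = 0" if "k \<le> i" "i < m" "j \<noteq> k" for i j
  proof (cases "j < k")
    case True
    then show ?thesis using tri[of j i] that by simp
  next
    case False
    then show ?thesis using that Suc.prems by (simp add: supported_def)
  qed
  have "?w i = 0" if "k \<le> i" for i
  proof (cases "i < m")
    case True
    have "(\<Sum>j<m. K i j * v j) = (\<Sum>j\<in>{k}. K i j * v j)"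
      using zero[OF that True] Suc.prems by (intro sum.mono_neutral_right) auto
    \<comment> \<open>For \<open>i = k\<close> this is the cancellation produced by the diagonal
      shift; for \<open>i > k\<close> the left side vanishes by triangularity and the right side by
      the support of \<open>v\<close>.\<close>
    moreover have "K i k * v k = K k k * v i"
      using tri[of k i] that True Suc.prems by (cases "i = k") (auto simp: supported_def)
    ultimately show ?thesis using True by (simp add: mvec_def)
  next
    case False
    then show ?thesis using that Suc.prems by (simp add: mvec_def supported_def)
  qed
  then have "supported k ?w" by (simp add: supported_def)
  with Suc.IH[of ?w] Suc.prems(1) show ?case
    by (simp add: shift_prod_append)
qed

lemma mvec_mult_mat:
  assumes "A \<in> carrier_mat m m" "B \<in> carrier_mat m m"
  shows "mvec m (\<lambda>i j. (A * B) $$ (i,j)) v = mvec m (\<lambda>i j. A $$ (i,j)) (mvec m (\<lambda>i j. B $$ (i,j)) v)"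
proof
  fix i
  have "(\<Sum>j<m. (A * B) $$ (i,j) * v j) = (\<Sum>k<m. A $$ (i,k) * (\<Sum>j<m. B $$ (k,j) * v j))" if "i < m"
  proof -
    have "(\<Sum>j<m. (A * B) $$ (i,j) * v j) = (\<Sum>j<m. \<Sum>k<m. A $$ (i,k) * (B $$ (k,j) * v j))"
      using assms that
      by (intro sum.cong) (auto simp: scalar_prod_def atLeast0LessThan sum_distrib_right mult.assoc)
    also have "\<dots> = (\<Sum>k<m. \<Sum>j<m. A $$ (i,k) * (B $$ (k,j) * v j))"
      by (rule sum.swap)
    finally show ?thesis by (simp add: sum_distrib_left)
  qed
  then show "mvec m (\<lambda>i j. (A * B) $$ (i,j)) v i = mvec m (\<lambda>i j. A $$ (i,j)) (mvec m (\<lambda>i j. B $$ (i,j)) v) i"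
    by (simp add: mvec_def)
qed

lemma mvec_one_mat:
  assumes "supported m v"
  shows "mvec m (\<lambda>i j. (1\<^sub>m m :: 'a::comm_ring_1 mat) $$ (i,j)) v = v"
proof
  fix i
  have "(\<Sum>j<m. (1\<^sub>m m :: 'a mat) $$ (i,j) * v j) = (\<Sum>j\<in>{i}. v j)" if "i < m"
    using that by (intro sum.mono_neutral_cong_right) auto
  then show "mvec m (\<lambda>i j. (1\<^sub>m m :: 'a mat) $$ (i,j)) v i = v i"
    using assms by (auto simp: mvec_def supported_def)
qed

text \<open>Conjugation by the similarity matrix commutes with polynomials in the operator, so the
  claim reduces to the Jordan matrix, which is upper triangular.\<close>

lemma jordan_nf_shift_prod:
  assumes nf: "jordan_nf M n_as" and M: "M \<in> carrier_mat m m" and v: "supported m v"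
  shows "shift_prod (mvec m (\<lambda>i j. M $$ (i,j))) (diag_mat (jordan_matrix n_as)) v = (\<lambda>i. 0)"
proof -
  let ?T = "jordan_matrix n_as"
  from nf have "similar_mat M ?T" by (simp add: jordan_nf_def)
  then obtain P Q where "similar_mat_wit M ?T P Q" by (auto simp: similar_mat_def)
  from similar_mat_witD2[OF M this]
  have wit: "P * Q = 1\<^sub>m m" "Q * P = 1\<^sub>m m" "M = P * ?T * Q"
    and carr: "?T \<in> carrier_mat m m" "P \<in> carrier_mat m m" "Q \<in> carrier_mat m m"
    by auto
  let ?op = "\<lambda>A :: 'a mat. mvec m (\<lambda>i j. A $$ (i,j))"
  have sim: "shift_prod (?op M) as v = ?op P (shift_prod (?op ?T) as (?op Q v))" for as
  proof (induction as)
    case Nil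
    show ?case
      using carr v wit by (simp add: mvec_one_mat flip: mvec_mult_mat)
  next
    case (Cons a as)
    let ?u = "shift_prod (?op ?T) as (?op Q v)"
    have u: "supported m ?u" by (simp add: supported_shift_prod)
    have "?op M (?op P ?u) = ?op (M * P) ?u"
      using carr M by (simp add: mvec_mult_mat)
    also have "M * P = P * ?T * (Q * P)"
      unfolding wit(3) using carr by (intro assoc_mult_mat[of _ m m _ m _ m]) auto
    also have "\<dots> = P * ?T" 
      using right_mult_one_mat[OF mult_carrier_mat[OF carr(2,1)]] by (simp add: wit(2))
    also have "?op (P * ?T) ?u = ?op P (?op ?T ?u)"
      using carr by (simp add: mvec_mult_mat)
    finally show ?case
      by (simp add: Cons.IH mvec_diff_scale)
  qed
  have diag: "diag_mat ?T = map (\<lambda>i. ?T $$ (i,i)) [0..<m]"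
    using carr by (auto simp: diag_mat_def)
  have "shift_prod (?op ?T) (diag_mat ?T) (?op Q v) = (\<lambda>i. 0)"
    unfolding diag
  proof (rule shift_prod_upper_triangular)
    show "?T $$ (i,j) = 0" if "j < i" "i < m" for i j
      using jordan_matrix_upper_triangular[of i n_as j] that carr by auto
  qed auto
  with sim show ?thesis by simp
qed

lemma shift_prod_mvec_swap:
  "shift_prod (mvec m K) (a # b # as) v = shift_prod (mvec m K) (b # a # as) v"
  by (simp add: mvec_diff_scale algebra_simps)

lemma shift_prod_mvec_move:
  "shift_prod (mvec m K) (as @ a # bs) v = shift_prod (mvec m K) (a # as @ bs) v"
proof (induction as)
  case (Cons b as)
  have "shift_prod (mvec m K) ((b # as) @ a # bs) v = shift_prod (mvec m K) (b # a # as @ bs) v"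
    using Cons by simp
  then show ?case by (simp only: shift_prod_mvec_swap append_Cons)
qed simp

text \<open>The factors \<open>T - a\<close> commute, so only the multiset of roots matters and
  roots may be rearranged at will.\<close>

lemma shift_prod_mvec_mset_cong:
  "mset as = mset bs \<Longrightarrow> shift_prod (mvec m K) as v = shift_prod (mvec m K) bs v"
proof (induction as arbitrary: bs)
  case (Cons a as)
  from Cons.prems have "a \<in> set bs" by (metis list.set_intros(1) set_mset_mset)
  then obtain cs ds where bs: "bs = cs @ a # ds" by (auto simp: in_set_conv_decomp)
  with Cons.prems have "mset as = mset (cs @ ds)" by simp
  from Cons.IH[OF this] show ?case
    unfolding bs by (simp only: shift_prod_mvec_move shift_prod_Cons)
qed simp

definition annihilates :: "nat \<Rightarrow> (nat \<Rightarrow> nat \<Rightarrow> 'a) \<Rightarrow> 'a::comm_ring_1 list \<Rightarrow> bool" where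
  "annihilates m K as \<longleftrightarrow> (\<forall>v. supported m v \<longrightarrow> shift_prod (mvec m K) as v = (\<lambda>i. 0))"

lemma annihilates_mset_cong: "mset as = mset bs \<Longrightarrow> annihilates m K as \<longleftrightarrow> annihilates m K bs"
  unfolding annihilates_def using shift_prod_mvec_mset_cong by metis

lemma annihilates_ConsI: "annihilates m K as \<Longrightarrow> annihilates m K (a # as)"
  by (simp add: annihilates_def)

definition has_eigenvector :: "nat \<Rightarrow> (nat \<Rightarrow> nat \<Rightarrow> 'a) \<Rightarrow> 'a::comm_ring_1 \<Rightarrow> bool" where
  "has_eigenvector m K a \<longleftrightarrow>
     (\<exists>v. supported m v \<and> v \<noteq> (\<lambda>i. 0) \<and> mvec m K v = (\<lambda>i. a * v i))"

text \<open>If \<open>a\<close> is not an eigenvalue, \<open>T - a\<close> is injective, so whatever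
  it kills is already zero.\<close>

lemma annihilates_drop:
  assumes "annihilates m K (a # as)" and "\<not> has_eigenvector m K a"
  shows "annihilates m K as"
  unfolding annihilates_def
proof (intro allI impI)
  fix v :: "nat \<Rightarrow> 'a" assume v: "supported m v"
  let ?u = "shift_prod (mvec m K) as v"
  have eig: "mvec m K ?u = (\<lambda>i. a * ?u i)"
    using assms(1) v by (auto simp: annihilates_def fun_eq_iff)
  show "?u = (\<lambda>i. 0)"
  proof (rule ccontr)
    assume "?u \<noteq> (\<lambda>i. 0)"
    with eig supported_shift_prod[OF v] have "has_eigenvector m K a"
      unfolding has_eigenvector_def by (intro exI[of _ ?u] conjI)
    with assms(2) show False by simp
  qed
qed

section \<open>Annihilating polynomials of real symmetric matrices: real and simple roots\<close>

lemma sum_mult_cnj_self_eq_0: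
  assumes "supported m u" and "(\<Sum>i<m. u i * cnj (u i)) = 0"
  shows "u = (\<lambda>i. 0)"
proof -
  have "(\<Sum>i<m. u i * cnj (u i)) = of_real (\<Sum>i<m. (cmod (u i))\<^sup>2)"
    by (simp flip: complex_norm_square)
  with assms(2) have "(\<Sum>i<m. (cmod (u i))\<^sup>2) = 0"
    by (simp only: of_real_eq_0_iff)
  then have "\<forall>i<m. u i = 0" by (subst (asm) sum_nonneg_eq_0_iff) auto
  then show ?thesis using assms(1) unfolding supported_def fun_eq_iff by (meson not_less)
qed

lemma mvec_hermitian:
  assumes "\<forall>i<m. \<forall>j<m. K i j = K j i"
  shows "(\<Sum>i<m. mvec m (\<lambda>i j. complex_of_real (K i j)) u i * cnj (w i)) =
         (\<Sum>i<m. u i * cnj (mvec m (\<lambda>i j. complex_of_real (K i j)) w i))"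
proof -
  have "(\<Sum>i<m. mvec m (\<lambda>i j. complex_of_real (K i j)) u i * cnj (w i)) =
        (\<Sum>i<m. \<Sum>j<m. of_real (K i j) * u j * cnj (w i))"
    by (simp add: mvec_def sum_distrib_right)
  also have "\<dots> = (\<Sum>j<m. \<Sum>i<m. of_real (K i j) * u j * cnj (w i))"
    by (rule sum.swap)
  also have "\<dots> = (\<Sum>j<m. \<Sum>i<m. u j * (of_real (K j i) * cnj (w i)))"
    using assms by (intro sum.cong refl) simp
  finally show ?thesis by (simp add: mvec_def sum_distrib_left)
qed

lemma eigenvalue_of_symmetric_real:
  assumes sym: "\<forall>i<m. \<forall>j<m. K i j = K j i"
    and "has_eigenvector m (\<lambda>i j. complex_of_real (K i j)) a"
  shows "a \<in> \<real>"
proof -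
  let ?T = "mvec m (\<lambda>i j. complex_of_real (K i j))"
  obtain u where u: "supported m u" "u \<noteq> (\<lambda>i. 0)" "?T u = (\<lambda>i. a * u i)"
    using assms(2) by (auto simp: has_eigenvector_def)
  have "a * (\<Sum>i<m. u i * cnj (u i)) = cnj a * (\<Sum>i<m. u i * cnj (u i))"
    using mvec_hermitian[OF sym, where u=u and w=u] by (simp add: u(3) sum_distrib_left mult_ac)
  moreover have "(\<Sum>i<m. u i * cnj (u i)) \<noteq> 0"
    using sum_mult_cnj_self_eq_0[OF u(1)] u(2) by auto
  ultimately show ?thesis by (simp add: Reals_cnj_iff)
qed

text \<open>Semisimplicity: if \<open>w = (T - a) u\<close> and \<open>(T - a) w = 0\<close> with
  \<open>a\<close> real, then the squared norm of \<open>w\<close> is the inner product of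
  \<open>u\<close> with \<open>(T - a) w\<close>, hence 0.\<close>

lemma annihilates_drop_duplicate:
  assumes sym: "\<forall>i<m. \<forall>j<m. K i j = K j i"
    and ann: "annihilates m (\<lambda>i j. complex_of_real (K i j)) (a # a # as)" and a: "a \<in> \<real>"
  shows "annihilates m (\<lambda>i j. complex_of_real (K i j)) (a # as)"
  unfolding annihilates_def
proof (intro allI impI)
  fix v :: "nat \<Rightarrow> complex" assume v: "supported m v"
  let ?T = "mvec m (\<lambda>i j. complex_of_real (K i j))"
  define u where "u = shift_prod ?T as v"
  define w where "w = shift_prod ?T (a # as) v"
  have w: "supported m w" unfolding w_def by (rule supported_shift_prod[OF v])
  have wu: "w = (\<lambda>i. ?T u i - a * u i)" by (simp add: w_def u_def)
  have "shift_prod ?T (a # a # as) v = (\<lambda>i. 0)"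
    using ann v by (simp only: annihilates_def)
  then have Tw: "?T w = (\<lambda>i. a * w i)"
    by (simp add: fun_eq_iff w_def)
  have "(\<Sum>i<m. w i * cnj (w i)) = (\<Sum>i<m. ?T u i * cnj (w i)) - a * (\<Sum>i<m. u i * cnj (w i))"
    by (subst (1) wu) (simp add: sum_distrib_left left_diff_distrib sum_subtractf mult.assoc)
  also have "(\<Sum>i<m. ?T u i * cnj (w i)) = (\<Sum>i<m. u i * cnj (?T w i))"
    by (rule mvec_hermitian[OF sym])
  also have "\<dots> = a * (\<Sum>i<m. u i * cnj (w i))"
    unfolding Tw using a by (simp add: sum_distrib_left mult_ac Reals_cnj_iff)
  finally show "shift_prod ?T (a # as) v = (\<lambda>i. 0)"
    unfolding w_def[symmetric] by (intro sum_mult_cnj_self_eq_0[OF w]) simp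
qed

text \<open>Here \<open>bs\<close> accumulates the distinct real roots already met. The next root is
  dropped if it is not real, because it cannot be an eigenvalue; it is dropped as a duplicate if it
  lies in \<open>bs\<close>; otherwise it moves to \<open>bs\<close>.\<close>

lemma annihilates_distinct_reals:
  assumes sym: "\<forall>i<m. \<forall>j<m. K i j = K j i"
  shows "\<lbrakk>annihilates m (\<lambda>i j. complex_of_real (K i j)) (as @ bs); distinct bs; set bs \<subseteq> \<real>;
          distinct cs; set cs = set bs \<union> (set as \<inter> \<real>)\<rbrakk>
         \<Longrightarrow> annihilates m (\<lambda>i j. complex_of_real (K i j)) cs"
proof (induction as arbitrary: bs)
  case Nil
  then have "mset bs = mset cs"
    by (subst set_eq_iff_mset_eq_distinct[symmetric]) auto
  then show ?case using Nil(1) annihilates_mset_cong by auto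
next
  case (Cons a as)
  let ?ann = "annihilates m (\<lambda>i j. complex_of_real (K i j))"
  consider "a \<notin> \<real>" | "a \<in> \<real>" "a \<in> set bs" | "a \<in> \<real>" "a \<notin> set bs" by blast
  then show ?case
  proof cases
    case 1
    then have "?ann (as @ bs)"
      using Cons.prems(1) annihilates_drop eigenvalue_of_symmetric_real[OF sym] by fastforce
    from Cons.IH[OF this] Cons.prems 1 show ?thesis by auto
  next
    case 2
    then obtain ds es where bs: "bs = ds @ a # es" by (auto simp: in_set_conv_decomp)
    have "?ann (a # a # as @ ds @ es)"
      using Cons.prems(1) annihilates_mset_cong[of "(a # as) @ bs" "a # a # as @ ds @ es"]
      by (simp add: bs)
    then have "?ann (a # as @ ds @ es)"
      by (rule annihilates_drop_duplicate[OF sym]) (use 2 in auto)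
    then have "?ann (as @ bs)"
      using annihilates_mset_cong[of "as @ bs" "a # as @ ds @ es"] by (simp add: bs)
    from Cons.IH[OF this] Cons.prems 2 show ?thesis by auto
  next
    case 3
    have "?ann (as @ a # bs)"
      using Cons.prems(1) annihilates_mset_cong[of "(a # as) @ bs" "as @ a # bs"] by simp
    from Cons.IH[OF this] Cons.prems 3 show ?thesis by auto
  qed
qed

lemma shift_prod_of_real:
  "shift_prod (mvec m (\<lambda>i j. complex_of_real (K i j))) (map complex_of_real rs) (\<lambda>i. of_real (v i)) =
   (\<lambda>i. of_real (shift_prod (mvec m K) rs v i))"
  by (induction rs) (auto simp: mvec_def fun_eq_iff)

text \<open>The list depends on the Jordan data \<open>n_as\<close> alone. All symmetric matrices
  with this Jordan form therefore share one annihilating polynomial with simple real roots.\<close>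

definition real_diagonal :: "(nat \<times> complex) list \<Rightarrow> real list" where
  "real_diagonal n_as = remdups (map Re (filter (\<lambda>a. a \<in> \<real>) (diag_mat (jordan_matrix n_as))))"

lemma jordan_nf_annihilates:
  assumes "jordan_nf (map_mat complex_of_real A) n_as" and A: "A \<in> carrier_mat m m"
    and sym: "\<forall>i<m. \<forall>j<m. A $$ (i,j) = A $$ (j,i)"
  shows "annihilates m (\<lambda>i j. A $$ (i,j)) (real_diagonal n_as)"
proof -
  let ?K = "\<lambda>i j. A $$ (i,j)" and ?D = "diag_mat (jordan_matrix n_as)"
  have eq: "mvec m (\<lambda>i j. map_mat complex_of_real A $$ (i,j)) = mvec m (\<lambda>i j. of_real (A $$ (i,j)))"
    using A by (auto simp: mvec_def fun_eq_iff intro!: sum.cong)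
  have "annihilates m (\<lambda>i j. complex_of_real (?K i j)) (?D @ [])"
    unfolding annihilates_def using jordan_nf_shift_prod[OF assms(1), of m] A eq by auto
  moreover have "distinct (map complex_of_real (real_diagonal n_as))"
    by (simp add: real_diagonal_def distinct_map inj_on_def)
  moreover have "set (map complex_of_real (real_diagonal n_as)) = set ?D \<inter> \<real>"
    by (force simp: real_diagonal_def image_iff elim: Reals_cases)
  ultimately have "annihilates m (\<lambda>i j. complex_of_real (?K i j)) (map complex_of_real (real_diagonal n_as))"
    using annihilates_distinct_reals[of m ?K ?D "[]"] sym by auto
  then show ?thesis
    unfolding annihilates_def
  proof (intro allI impI, goal_cases)
    case (1 v)
    then have "supported m (\<lambda>i. complex_of_real (v i))" by (simp add: supported_def)
    with 1 have "(\<lambda>i. complex_of_real (shift_prod (mvec m ?K) (real_diagonal n_as) v i)) = (\<lambda>i. 0)"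
      by (simp flip: shift_prod_of_real)
    then show ?case by (simp add: fun_eq_iff)
  qed
qed

text \<open>The list \<open>bs\<close> makes the induction work: it receives the roots that have
  been examined and kept.\<close>

lemma annihilates_filter:
  "annihilates m K (as @ bs) \<Longrightarrow> annihilates m K (filter (has_eigenvector m K) as @ bs)"
proof (induction as arbitrary: bs)
  case (Cons a as)
  show ?case
  proof (cases "has_eigenvector m K a")
    case True
    have "annihilates m K (as @ a # bs)"
      using Cons.prems annihilates_mset_cong[of "(a # as) @ bs" "as @ a # bs"] by simp
    from Cons.IH[OF this] show ?thesis
      using True annihilates_mset_cong[of "filter (has_eigenvector m K) as @ a # bs"
          "filter (has_eigenvector m K) (a # as) @ bs"] by simp
  next
    case False
    with Cons.prems annihilates_drop have "annihilates m K (as @ bs)" by fastforce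
    from Cons.IH[OF this] False show ?thesis by simp
  qed
qed simp

lemma annihilates_mono:
  assumes "annihilates m K as" "distinct as" "set as \<subseteq> set bs"
  shows "annihilates m K bs"
proof -
  have "count (mset as) a \<le> count (mset bs) a" for a
    using assms(2,3) by (cases "a \<in> set as") (auto simp: distinct_count_atmost_1 Suc_le_eq)
  then have "mset as \<subseteq># mset bs" by (simp add: subseteq_mset_def)
  then obtain M where M: "mset bs = M + mset as" by (metis subset_mset.le_iff_add add.commute)
  obtain cs where cs: "mset cs = M" by (metis ex_mset)
  have "annihilates m K (cs @ as)"
    by (induction cs) (use assms(1) annihilates_ConsI in auto)
  then show ?thesis using M cs annihilates_mset_cong[of "cs @ as" bs] by simp
qed

lemma mvec_unit: "k < m \<Longrightarrow> i < m \<Longrightarrow> mvec m K (\<lambda>i. if i = k then 1 else 0) i = K i k"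
  by (simp add: mvec_def if_distrib cong: if_cong)

text \<open>If at most one nonzero number \<open>l\<close> were an eigenvalue, then \<open>K\<^sup>2 = l K\<close>, so the squared
  Frobenius norm of \<open>K\<close> would be \<open>l\<close> times its trace.\<close>

lemma two_nonzero_eigenvalues:
  fixes K :: "nat \<Rightarrow> nat \<Rightarrow> real"
  assumes sym: "\<forall>i<m. \<forall>j<m. K i j = K j i" and trace: "(\<Sum>i<m. K i i) = 0"
    and ann: "annihilates m K rs" and "distinct rs"
    and nz: "i0 < m" "j0 < m" "K i0 j0 \<noteq> 0"
  obtains l \<mu> where "l \<in> set rs" "\<mu> \<in> set rs" "l \<noteq> \<mu>" "l \<noteq> 0" "\<mu> \<noteq> 0"
    "has_eigenvector m K l" "has_eigenvector m K \<mu>"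
proof (rule ccontr)
  assume neg: "\<not> thesis"
  have le1: "l = \<mu>" if "l \<in> set rs" "\<mu> \<in> set rs" "l \<noteq> 0" "\<mu> \<noteq> 0"
    "has_eigenvector m K l" "has_eigenvector m K \<mu>" for l \<mu>
    using \<open>\<And>\<mu> l. \<lbrakk>l \<in> set rs; \<mu> \<in> set rs; l \<noteq> \<mu>; l \<noteq> 0; \<mu> \<noteq> 0; has_eigenvector m K l; has_eigenvector m K \<mu>\<rbrakk> \<Longrightarrow> thesis\<close>
      neg that by blast
  let ?E = "filter (has_eigenvector m K) rs"
  \<comment> \<open>If no nonzero root is an eigenvalue, any \<open>l\<close> serves; otherwise
    \<open>l\<close> is the unique nonzero eigenvalue among the roots.\<close>
  have "\<exists>l. set ?E \<subseteq> set [0, l]"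
  proof (cases "set ?E \<subseteq> {0}")
    case False
    then obtain l where l: "l \<in> set ?E" "l \<noteq> 0" by auto
    have "\<mu> \<in> {0, l}" if "\<mu> \<in> set ?E" for \<mu>
      using that l le1[of l \<mu>] by auto
    then show ?thesis by auto
  qed auto
  then obtain l where l: "set ?E \<subseteq> set [0, l]" by blast
  have "annihilates m K ?E"
    using annihilates_filter[of m K rs "[]"] ann by simp
  then have "annihilates m K [0, l]"
    by (rule annihilates_mono) (use \<open>distinct rs\<close> l in auto)
  then have TT: "mvec m K (mvec m K v) = (\<lambda>i. l * mvec m K v i)" if "supported m v" for v
    using that by (simp add: annihilates_def mvec_diff_scale fun_eq_iff)
  \<comment> \<open>This compares the \<open>k\<close>-th diagonal entries of
    \<open>K\<^sup>2\<close> and \<open>l K\<close> by applying both to the \<open>k\<close>-th unit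
    vector; by symmetry the former is the squared norm of row \<open>k\<close>.\<close>
  have "(\<Sum>j<m. K k j * K k j) = l * K k k" if "k < m" for k
  proof -
    let ?e = "\<lambda>i. if i = k then 1 else (0::real)"
    have "supported m ?e" using that by (auto simp: supported_def)
    from TT[OF this] have "mvec m K (mvec m K ?e) k = l * mvec m K ?e k" by metis
    moreover have "mvec m K (mvec m K ?e) k = (\<Sum>j<m. K k j * mvec m K ?e j)"
      using that by (simp add: mvec_def)
    moreover have "\<dots> = (\<Sum>j<m. K k j * K k j)"
      using that sym by (intro sum.cong) (auto simp: mvec_unit)
    ultimately show ?thesis using that by (simp add: mvec_unit)
  qed
  then have "(\<Sum>k<m. \<Sum>j<m. K k j * K k j) = 0"
    using trace by (simp flip: sum_distrib_left)
  moreover have "(\<Sum>k<m. \<Sum>j<m. K k j * K k j) > 0"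
    using nz by (intro sum_pos2[of _ i0] sum_pos2[of _ j0] sum_nonneg) (auto simp: zero_less_mult_iff)
  ultimately show False by simp
qed

section \<open>Eigenspace projections by Lagrange interpolation\<close>

definition eigproj :: "nat \<Rightarrow> (nat \<Rightarrow> nat \<Rightarrow> real) \<Rightarrow> real list \<Rightarrow> real \<Rightarrow> (nat \<Rightarrow> real) \<Rightarrow> nat \<Rightarrow> real" where
  "eigproj m K rs l v i = shift_prod (mvec m K) (remove1 l rs) v i / (\<Prod>a\<leftarrow>remove1 l rs. l - a)"

lemma supported_eigproj: "supported m v \<Longrightarrow> supported m (eigproj m K rs l v)"
  using supported_shift_prod[of m v K "remove1 l rs"] by (simp add: supported_def eigproj_def)

text \<open>The projection is the Lagrange polynomial that is 1 at \<open>l\<close> and 0 at the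
  other roots, evaluated at the matrix. Multiplied by \<open>T - l\<close> it becomes a multiple of
  the annihilating polynomial.\<close>

lemma eigproj_eigenvector:
  assumes "annihilates m K rs" "l \<in> set rs" "supported m v"
  shows "mvec m K (eigproj m K rs l v) = (\<lambda>i. l * eigproj m K rs l v i)"
proof -
  have "annihilates m K (l # remove1 l rs)"
    using assms(1,2) annihilates_mset_cong[of rs "l # remove1 l rs"] by simp
  then have "mvec m K (shift_prod (mvec m K) (remove1 l rs) v) = (\<lambda>i. l * shift_prod (mvec m K) (remove1 l rs) v i)"
    using assms(3) by (simp add: annihilates_def fun_eq_iff)
  then show ?thesis
    using mvec_scale[of m K "1 / (\<Prod>a\<leftarrow>remove1 l rs. l - a)" "shift_prod (mvec m K) (remove1 l rs) v"]
    by (simp add: eigproj_def[abs_def])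
qed

lemma shift_prod_eigenvector:
  assumes "mvec m K v = (\<lambda>i. l * v i)"
  shows "shift_prod (mvec m K) as v = (\<lambda>i. (\<Prod>a\<leftarrow>as. l - a) * v i)"
  by (induction as) (simp_all add: mvec_scale assms left_diff_distrib mult.assoc mult.left_commute)

lemma eigproj_fixes_eigenvector:
  assumes "mvec m K v = (\<lambda>i. l * v i)" "distinct rs"
  shows "eigproj m K rs l v = v"
proof -
  have "(\<Prod>a\<leftarrow>remove1 l rs. l - a) \<noteq> 0"
    using assms(2) by (auto simp: prod_list_zero_iff)
  then show ?thesis
    by (simp add: eigproj_def fun_eq_iff shift_prod_eigenvector[OF assms(1)])
qed

lemma mvec_sum: "mvec m K (\<lambda>i. \<Sum>j\<in>J. c j * u j i) = (\<lambda>i. \<Sum>j\<in>J. c j * mvec m K (u j) i)"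
proof
  fix i
  have "(\<Sum>k<m. K i k * (\<Sum>j\<in>J. c j * u j k)) = (\<Sum>k<m. \<Sum>j\<in>J. c j * (K i k * u j k))"
    by (simp add: sum_distrib_left mult_ac)
  also have "\<dots> = (\<Sum>j\<in>J. \<Sum>k<m. c j * (K i k * u j k))" by (rule sum.swap)
  finally show "mvec m K (\<lambda>i. \<Sum>j\<in>J. c j * u j i) i = (\<Sum>j\<in>J. c j * mvec m K (u j) i)"
    by (simp add: mvec_def sum_distrib_left)
qed

lemma shift_prod_sum:
  "shift_prod (mvec m K) as (\<lambda>i. \<Sum>j\<in>J. c j * u j i) = (\<lambda>i. \<Sum>j\<in>J. c j * shift_prod (mvec m K) as (u j) i)"
  by (induction as) (simp_all add: mvec_sum right_diff_distrib sum_subtractf sum_distrib_left mult.left_commute)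

text \<open>Written as a matrix whose columns are the images of unit vectors, the projection can be
  controlled by finitely many continuous entries.\<close>

lemma eigproj_expand:
  assumes "supported m v"
  shows "eigproj m K rs l v i = (\<Sum>j<m. v j * eigproj m K rs l (\<lambda>i. if i = j then 1 else 0) i)"
proof -
  have v: "v = (\<lambda>i. \<Sum>j<m. v j * (if i = j then 1 else 0))"
    using assms by (auto simp: fun_eq_iff supported_def if_distrib not_less cong: if_cong)
  have "shift_prod (mvec m K) (remove1 l rs) v i =
      (\<Sum>j<m. v j * shift_prod (mvec m K) (remove1 l rs) (\<lambda>i. if i = j then 1 else 0) i)"
    by (subst v) (rule fun_cong[OF shift_prod_sum])
  then show ?thesis by (simp add: eigproj_def sum_divide_distrib)
qed

lemma continuous_on_shift_prod:
  fixes K :: "'b::topological_space \<Rightarrow> nat \<Rightarrow> nat \<Rightarrow> real"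
  assumes "\<And>i j. i < m \<Longrightarrow> j < m \<Longrightarrow> continuous_on S (\<lambda>x. K x i j)"
    and "\<And>i. continuous_on S (\<lambda>x. v x i)"
  shows "continuous_on S (\<lambda>x. shift_prod (mvec m (K x)) as (v x) i)"
proof (induction as arbitrary: i)
  case (Cons a as)
  have "continuous_on S (\<lambda>x. mvec m (K x) (shift_prod (mvec m (K x)) as (v x)) i)"
    by (cases "i < m") (auto simp: mvec_def intro!: continuous_intros assms(1) Cons)
  then show ?case by (auto intro!: continuous_intros Cons)
qed (simp add: assms(2))

text \<open>Since \<open>rs\<close> and \<open>l\<close> are the same for all \<open>x\<close>, the
  projection is one fixed polynomial in the entries of \<open>K x\<close>, so it depends
  continuously on \<open>x\<close>.\<close>

lemma continuous_on_eigproj: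
  fixes K :: "'b::topological_space \<Rightarrow> nat \<Rightarrow> nat \<Rightarrow> real"
  assumes "\<And>i j. i < m \<Longrightarrow> j < m \<Longrightarrow> continuous_on S (\<lambda>x. K x i j)"
    and "\<And>i. continuous_on S (\<lambda>x. v x i)"
  shows "continuous_on S (\<lambda>x. eigproj m (K x) rs l (v x) i)"
  unfolding eigproj_def divide_inverse
  by (intro continuous_on_mult_right continuous_on_shift_prod assms)

lemma continuous_on_coordinate [continuous_intros]:
  "continuous_on S f \<Longrightarrow> continuous_on S (\<lambda>x. f x i)"
  by (rule continuous_on_product_then_coordinatewise)

lemma unit_sphere_coordinate_le:
  assumes "x \<in> unit_sphere p"
  shows "\<bar>x i\<bar> \<le> 1"
proof (cases "i \<le> p")
  case True
  then have "(x i)\<^sup>2 \<le> (\<Sum>i\<le>p. (x i)\<^sup>2)" by (intro member_le_sum) auto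
  then show ?thesis using assms by (simp add: unit_sphere_def abs_square_le_1)
next
  case False
  then show ?thesis using assms by (simp add: unit_sphere_def)
qed

lemma compact_unit_sphere: "compact (unit_sphere p)"
proof -
  have "compactin (product_topology (\<lambda>i. euclidean) UNIV) (PiE UNIV (\<lambda>i::nat. {-1..1::real}))"
    by (simp add: compactin_PiE)
  then have "compact (PiE UNIV (\<lambda>i::nat. {-1..1::real}))"
    by (simp add: euclidean_product_topology)
  moreover have "closed (unit_sphere p)"
  proof -
    have "unit_sphere p = {x. (\<Sum>i\<le>p. (x i)\<^sup>2) = 1} \<inter> (\<Inter>i\<in>{p<..}. {x. x i = 0})"
      by (auto simp: unit_sphere_def)
    moreover have "closed \<dots>"
      by (intro closed_Int closed_INT ballI closed_Collect_eq continuous_intros continuous_on_id)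
    ultimately show ?thesis by simp
  qed
  moreover have "unit_sphere p \<subseteq> PiE UNIV (\<lambda>i. {-1..1})"
    using unit_sphere_coordinate_le by (fastforce simp: abs_le_iff)
  ultimately show ?thesis
    by (metis compact_Int_closed inf.absorb2)
qed

text \<open>The two closed pieces meet where \<open>c\<close> is 0, and there both branches vanish,
  so the pasting lemma applies. Continuity of \<open>f\<close> is asked for only where
  \<open>c\<close> is nonnegative, which suits fields defined on a cap.\<close>

lemma continuous_on_cutoff:
  fixes c f :: "'a::topological_space \<Rightarrow> real"
  assumes c: "continuous_on S c" and f: "continuous_on {x\<in>S. c x \<ge> 0} f"
  shows "continuous_on S (\<lambda>x. if c x \<ge> 0 then c x * f x else 0)"
proof -
  let ?A = "{x\<in>S. c x \<ge> 0}" and ?B = "{x\<in>S. c x \<le> 0}"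
  have S: "?A \<union> ?B = S" by auto
  have "S \<inter> c -` {0..} = ?A" "S \<inter> c -` {..0} = ?B" by auto
  then have "closedin (top_of_set S) ?A" "closedin (top_of_set S) ?B"
    using continuous_closedin_preimage[OF c closed_atLeast[of 0]]
      continuous_closedin_preimage[OF c closed_atMost[of 0]] by simp_all
  moreover have "continuous_on ?A (\<lambda>x. c x * f x)"
    by (intro continuous_on_mult f continuous_on_subset[OF c]) auto
  ultimately have "continuous_on (?A \<union> ?B) (\<lambda>x. if c x \<ge> 0 then c x * f x else 0)"
    by (intro continuous_on_cases_local) (unfold S, auto)
  then show ?thesis unfolding S .
qed

section \<open>Isospectral families of symmetric matrices on an even-dimensional sphere\<close>

locale isospectral_sphere =
  fixes p :: nat and K :: "(nat \<Rightarrow> real) \<Rightarrow> nat \<Rightarrow> nat \<Rightarrow> real" and rs :: "real list"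
  assumes even_p: "even p"
    and continuous_K: "\<And>i j. i \<le> p \<Longrightarrow> j \<le> p \<Longrightarrow> continuous_on (unit_sphere p) (\<lambda>x. K x i j)"
    and symmetric_K: "\<And>x. x \<in> unit_sphere p \<Longrightarrow> \<forall>i<Suc p. \<forall>j<Suc p. K x i j = K x j i"
    and kernel_K: "\<And>x i. x \<in> unit_sphere p \<Longrightarrow> i \<le> p \<Longrightarrow> (\<Sum>j\<le>p. K x i j * x j) = 0"
    and trace_K: "\<And>x. x \<in> unit_sphere p \<Longrightarrow> (\<Sum>i<Suc p. K x i i) = 0"
    and uminus_K: "\<And>x. x \<in> unit_sphere p \<Longrightarrow> K (\<lambda>i. - x i) = K x"
    and annihilates_K: "\<And>x. x \<in> unit_sphere p \<Longrightarrow> annihilates (Suc p) (K x) rs"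
    and distinct_rs: "distinct rs"
begin

abbreviation dot :: "(nat \<Rightarrow> real) \<Rightarrow> (nat \<Rightarrow> real) \<Rightarrow> real" where
  "dot x y \<equiv> \<Sum>i\<le>p. x i * y i"

text \<open>The chord from \<open>x0\<close> to \<open>x\<close> projected radially to the sphere:
  an arc of a great circle that starts at \<open>x0\<close> and ends at \<open>x\<close>.\<close>

definition path :: "(nat \<Rightarrow> real) \<Rightarrow> real \<Rightarrow> (nat \<Rightarrow> real) \<Rightarrow> nat \<Rightarrow> real" where
  "path x0 t x i = ((1 - t) * x0 i + t * x i) / sqrt (\<Sum>j\<le>p. ((1 - t) * x0 j + t * x j)\<^sup>2)"

text \<open>The bound -1/2 exceeds -1, so the chord stays away from the origin: its squared norm is
  at least \<open>3 * (t - 1/2)\<^sup>2 + 1/4\<close>. It is negative, so the caps around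
  \<open>x0\<close> and its antipode overlap and cover the sphere.\<close>

lemma path_norm_pos:
  assumes "x0 \<in> unit_sphere p" "x \<in> unit_sphere p" "dot x x0 \<ge> -1/2" "0 \<le> t" "t \<le> 1"
  shows "(\<Sum>j\<le>p. ((1 - t) * x0 j + t * x j)\<^sup>2) > 0"
proof -
  have "(\<Sum>j\<le>p. ((1 - t) * x0 j + t * x j)\<^sup>2) =
        (1 - t)\<^sup>2 * (\<Sum>j\<le>p. (x0 j)\<^sup>2) + t\<^sup>2 * (\<Sum>j\<le>p. (x j)\<^sup>2) + 2 * t * (1 - t) * dot x x0"
    by (simp add: sum_distrib_left flip: sum.distrib)
       (intro sum.cong refl, simp add: power2_eq_square algebra_simps)
  also have "\<dots> = (1 - t)\<^sup>2 + t\<^sup>2 + 2 * (t * (1 - t)) * dot x x0"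
    using assms by (simp add: unit_sphere_def)
  also have "\<dots> \<ge> (1 - t)\<^sup>2 + t\<^sup>2 + 2 * (t * (1 - t)) * (-1/2)"
    using assms by (intro add_left_mono mult_left_mono) auto
  also have "(1 - t)\<^sup>2 + t\<^sup>2 + 2 * (t * (1 - t)) * (-1/2) = 3 * (t - 1/2)\<^sup>2 + 1/4"
    by (simp add: power2_eq_square field_simps)
  finally show ?thesis
    by (smt (verit) zero_le_power2 divide_pos_pos)
qed

lemma path_in_unit_sphere:
  assumes "x0 \<in> unit_sphere p" "x \<in> unit_sphere p" "dot x x0 \<ge> -1/2" "0 \<le> t" "t \<le> 1"
  shows "path x0 t x \<in> unit_sphere p"
  using path_norm_pos[OF assms] assms(1,2)
  by (simp add: unit_sphere_def path_def[abs_def] power_divide sum_nonneg flip: sum_divide_distrib)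

lemma path_0: "x0 \<in> unit_sphere p \<Longrightarrow> path x0 0 x = x0"
  by (simp add: path_def[abs_def] unit_sphere_def)

lemma path_1: "x \<in> unit_sphere p \<Longrightarrow> path x0 1 x = x"
  by (simp add: path_def[abs_def] unit_sphere_def)

text \<open>Transport of an eigenvector along great circles from \<open>x0\<close>, discretised into steps so short that
  the projection onto the next eigenspace is injective on the previous one.\<close>

lemma eigenvector_field:
  assumes x0: "x0 \<in> unit_sphere p" and l: "l \<in> set rs" and ev: "has_eigenvector (Suc p) (K x0) l"
  obtains v where "\<And>i. continuous_on {x \<in> unit_sphere p. dot x x0 \<ge> -1/2} (\<lambda>x. v x i)"
    and "\<And>x. x \<in> unit_sphere p \<Longrightarrow> dot x x0 \<ge> -1/2 \<Longrightarrow>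
           supported (Suc p) (v x) \<and> v x \<noteq> (\<lambda>i. 0) \<and> mvec (Suc p) (K x) (v x) = (\<lambda>i. l * v x i)"
proof -
  let ?m = "Suc p" and ?U = "{x \<in> unit_sphere p. dot x x0 \<ge> -1/2}"
  let ?e = "\<lambda>j i. if i = j then 1 else (0::real)"
  \<comment> \<open>\<open>A t x\<close> projects onto the \<open>l\<close>-eigenspace over the
    point at time \<open>t\<close> of the path towards \<open>x\<close>.\<close>
  define A where "A = (\<lambda>t x. eigproj ?m (K (path x0 t x)) rs l)"
  have in_S: "path x0 t x \<in> unit_sphere p" if "x \<in> ?U" "t \<in> {0..1}" for t x
    using path_in_unit_sphere[OF x0] that by auto
  have path_cont: "continuous_on ({0..1} \<times> ?U) (\<lambda>z. path x0 (fst z) (snd z))"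
  proof (intro continuous_on_coordinatewise_then_product)
    fix i
    have "sqrt (\<Sum>j\<le>p. ((1 - fst z) * x0 j + fst z * snd z j)\<^sup>2) \<noteq> 0" if "z \<in> {0..1} \<times> ?U" for z
      using path_norm_pos[OF x0, of "snd z" "fst z"] that by auto
    then show "continuous_on ({0..1} \<times> ?U) (\<lambda>z. path x0 (fst z) (snd z) i)"
      unfolding path_def by (intro continuous_intros continuous_on_id) auto
  qed
  have K_cont: "continuous_on ({0..1} \<times> ?U) (\<lambda>z. K (path x0 (fst z) (snd z)) i j)" if "i < ?m" "j < ?m" for i j
    by (rule continuous_on_compose2[OF continuous_K path_cont]) (use that in_S in auto)
  have A_cont: "continuous_on ({0..1} \<times> ?U) (\<lambda>z. A (fst z) (snd z) (?e j) i)" for i j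
    unfolding A_def by (intro continuous_on_eigproj K_cont continuous_intros)
  \<comment> \<open>\<open>D\<close> is the entrywise distance between the projections at times
    \<open>s\<close> and \<open>t\<close>. It is 0 for \<open>s = t\<close>, so uniform continuity
    on a compact set provides one step length \<open>\<delta>\<close> below which \<open>D\<close>
    is less than 1 for all \<open>x\<close> at once.\<close>
  define D where "D = (\<lambda>(s, t, x). \<Sum>i<?m. \<Sum>j<?m. \<bar>A s x (?e j) i - A t x (?e j) i\<bar>)"
  have c1: "continuous_on ({0..1} \<times> {0..1} \<times> ?U) (\<lambda>z. A (fst z) (snd (snd z)) (?e j) i)" for i j
  proof -
    have sub: "(\<lambda>z. (fst z, snd (snd z))) ` ({0..1} \<times> {0..1} \<times> ?U) \<subseteq> {0..1} \<times> ?U"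
      by auto
    have "continuous_on ({0..1} \<times> {0..1} \<times> ?U) (\<lambda>z. (fst z, snd (snd z)))"
      by (intro continuous_on_Pair continuous_on_fst continuous_on_snd continuous_on_id)
    from continuous_on_compose2[OF A_cont this sub, of j i] show ?thesis by simp
  qed
  have c2: "continuous_on ({0..1} \<times> {0..1} \<times> ?U) (\<lambda>z. A (fst (snd z)) (snd (snd z)) (?e j) i)" for i j
  proof -
    have sub: "(\<lambda>z. (fst (snd z), snd (snd z))) ` ({0..1} \<times> {0..1} \<times> ?U) \<subseteq> {0..1} \<times> ?U"
      by auto
    have "continuous_on ({0..1} \<times> {0..1} \<times> ?U) (\<lambda>z. (fst (snd z), snd (snd z)))"
      by (intro continuous_on_Pair continuous_on_fst continuous_on_snd continuous_on_id)
    from continuous_on_compose2[OF A_cont this sub, of j i] show ?thesis by simp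
  qed
  have "continuous_on ({0..1} \<times> {0..1} \<times> ?U) D"
    unfolding D_def case_prod_unfold
    by (intro continuous_on_sum continuous_on_rabs continuous_on_diff c1 c2)
  moreover have "compact ?U"
  proof -
    have "closed {x. dot x x0 \<ge> -1/2}"
      by (intro closed_Collect_le continuous_intros continuous_on_id)
    from compact_Int_closed[OF compact_unit_sphere this] show ?thesis
      by (simp add: Int_def)
  qed
  ultimately have uc: "uniformly_continuous_on ({0..1} \<times> {0..1} \<times> ?U) D"
    by (intro compact_uniformly_continuous compact_Times) auto
  have one: "0 < (1::real)" by simp
  obtain \<delta> where \<delta>: "\<delta> > 0"
    "\<And>y z. y \<in> {0..1} \<times> {0..1} \<times> ?U \<Longrightarrow> z \<in> {0..1} \<times> {0..1} \<times> ?U \<Longrightarrow> dist z y < \<delta> \<Longrightarrow> dist (D z) (D y) < 1"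
    by (rule uniformly_continuous_onE[OF uc one]) blast
  have D_small: "D (s, t, x) < 1" if "s \<in> {0..1}" "t \<in> {0..1}" "x \<in> ?U" "\<bar>s - t\<bar> < \<delta>" for s t x
  proof -
    have "dist (D (s, t, x)) (D (t, t, x)) < 1"
      using that by (intro \<delta>(2)) (auto simp: dist_Pair_Pair dist_real_def)
    then show ?thesis by (simp add: D_def dist_real_def)
  qed
  \<comment> \<open>If the projection at time \<open>s\<close> killed the eigenvector
    \<open>w\<close> at time \<open>t\<close>, then \<open>w\<close> would be its own image under
    the difference of the projections. Its 1-norm \<open>n\<close> would satisfy
    \<open>n \<le> n * D (s, t, x) < n\<close>.\<close>
  have step: "A s x w \<noteq> (\<lambda>i. 0)"
    if h: "s \<in> {0..1}" "t \<in> {0..1}" "x \<in> ?U" "\<bar>s - t\<bar> < \<delta>" "supported ?m w" "w \<noteq> (\<lambda>i. 0)"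
      "mvec ?m (K (path x0 t x)) w = (\<lambda>i. l * w i)" for s t x w
  proof
    assume zero: "A s x w = (\<lambda>i. 0)"
    have fix_w: "A t x w = w"
      unfolding A_def by (rule eigproj_fixes_eigenvector[OF h(7) distinct_rs])
    define n where "n = (\<Sum>j<?m. \<bar>w j\<bar>)"
    obtain j where "j < ?m" "w j \<noteq> 0"
      using h(5,6) unfolding supported_def fun_eq_iff by (meson not_less)
    then have "n > 0"
      unfolding n_def by (intro sum_pos2[of _ j]) auto
    have "\<bar>w i\<bar> \<le> (\<Sum>j<?m. n * \<bar>A s x (?e j) i - A t x (?e j) i\<bar>)" for i
    proof -
      have "w i = A t x w i - A s x w i" by (simp add: fix_w zero)
      also have "\<dots> = (\<Sum>j<?m. w j * (A t x (?e j) i - A s x (?e j) i))"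
        unfolding A_def eigproj_expand[OF h(5)] by (simp add: right_diff_distrib sum_subtractf del: sum.lessThan_Suc)
      finally have "\<bar>w i\<bar> \<le> (\<Sum>j<?m. \<bar>w j * (A t x (?e j) i - A s x (?e j) i)\<bar>)"
        by (elim ssubst) (rule sum_abs)
      also have "\<dots> \<le> (\<Sum>j<?m. n * \<bar>A s x (?e j) i - A t x (?e j) i\<bar>)"
        unfolding abs_mult n_def abs_minus_commute[of "A t x _ i"]
        by (intro sum_mono mult_right_mono member_le_sum) auto
      finally show ?thesis .
    qed
    then have "(\<Sum>i<?m. \<bar>w i\<bar>) \<le> (\<Sum>i<?m. \<Sum>j<?m. n * \<bar>A s x (?e j) i - A t x (?e j) i\<bar>)"
      by (rule sum_mono)
    then have "n \<le> n * D (s, t, x)"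
      unfolding D_def by (simp only: n_def[symmetric] prod.case sum_distrib_left)
    moreover have "n * D (s, t, x) < n * 1"
      using D_small[OF h(1-4)] \<open>n > 0\<close> by (intro mult_strict_left_mono)
    ultimately show False by simp
  qed
  obtain v0 where v0: "supported ?m v0" "v0 \<noteq> (\<lambda>i. 0)" "mvec ?m (K x0) v0 = (\<lambda>i. l * v0 i)"
    using ev by (auto simp: has_eigenvector_def)
  obtain N where N: "N > 0" "1 / real N < \<delta>"
    using \<delta>(1) by (metis nat_approx_posE zero_less_Suc)
  \<comment> \<open>The field at stage \<open>k\<close> consists of eigenvectors over the points at
    time \<open>k / N\<close>. It starts with the constant \<open>v0\<close>, since all paths begin
    at \<open>x0\<close>; each stage is projected to the next, and time 1 is reached at
    \<open>k = N\<close>.\<close>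
  have "\<exists>v. (\<forall>i. continuous_on ?U (\<lambda>x. v x i)) \<and> (\<forall>x\<in>?U. supported ?m (v x) \<and> v x \<noteq> (\<lambda>i. 0) \<and>
          mvec ?m (K (path x0 (k / N) x)) (v x) = (\<lambda>i. l * v x i))" if "k \<le> N" for k :: nat
    using that
  proof (induction k)
    case 0
    show ?case
      by (rule exI[of _ "\<lambda>x. v0"]) (use v0 in \<open>simp add: path_0[OF x0]\<close>)
  next
    case (Suc k)
    from Suc.IH[OF Suc_leD[OF Suc.prems]] obtain v where IH: "(\<forall>i. continuous_on ?U (\<lambda>x. v x i)) \<and>
        (\<forall>x\<in>?U. supported ?m (v x) \<and> v x \<noteq> (\<lambda>i. 0) \<and>
          mvec ?m (K (path x0 (k / N) x)) (v x) = (\<lambda>i. l * v x i))"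
      by (rule exE)
    note v = IH[THEN conjunct1, rule_format] IH[THEN conjunct2, THEN bspec]
    let ?s = "Suc k / N"
    have s: "?s \<in> {0..1}" "k / N \<in> {0..1}" and ds: "\<bar>?s - k / N\<bar> < \<delta>"
      using Suc.prems N by (auto simp: field_simps)
    have pair: "continuous_on ?U (\<lambda>x. (?s, x))"
      by (intro continuous_on_Pair continuous_on_const continuous_on_id)
    have sub: "(\<lambda>x. (?s, x)) ` ?U \<subseteq> {0..1} \<times> ?U"
      using s(1) by blast
    have "continuous_on ?U (\<lambda>x. K (path x0 ?s x) i j)" if "i < ?m" "j < ?m" for i j
      using continuous_on_compose2[OF K_cont[OF that] pair sub] by (simp only: fst_conv snd_conv)
    then have "continuous_on ?U (\<lambda>x. A ?s x (v x) i)" for i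
      unfolding A_def by (intro continuous_on_eigproj v(1))
    moreover have "supported ?m (A ?s x (v x)) \<and> A ?s x (v x) \<noteq> (\<lambda>i. 0) \<and>
        mvec ?m (K (path x0 ?s x)) (A ?s x (v x)) = (\<lambda>i. l * A ?s x (v x) i)" if x: "x \<in> ?U" for x
    proof (intro conjI)
      show "A ?s x (v x) \<noteq> (\<lambda>i. 0)"
        using v(2)[OF x] by (intro step[OF s x ds]) auto
      show "supported ?m (A ?s x (v x))"
        unfolding A_def using v(2)[OF x] by (intro supported_eigproj) auto
      show "mvec ?m (K (path x0 ?s x)) (A ?s x (v x)) = (\<lambda>i. l * A ?s x (v x) i)"
        unfolding A_def using v(2)[OF x]
        by (intro eigproj_eigenvector annihilates_K in_S l x s) auto
    qed
    ultimately show ?case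
      by (intro exI[of _ "\<lambda>x. A ?s x (v x)"] conjI[OF allI ballI])
  qed
  from this[OF order_refl] obtain v where v: "(\<forall>i. continuous_on ?U (\<lambda>x. v x i)) \<and>
      (\<forall>x\<in>?U. supported ?m (v x) \<and> v x \<noteq> (\<lambda>i. 0) \<and>
        mvec ?m (K (path x0 (N / N) x)) (v x) = (\<lambda>i. l * v x i))"
    by (rule exE)
  have "path x0 (N / N) x = x" if "x \<in> unit_sphere p" for x
    using N(1) path_1[OF that] by simp
  with v show thesis
    by (intro that[of v]) (simp_all del: One_nat_def)
qed

lemma symmetric_dot:
  assumes "x \<in> unit_sphere p"
  shows "dot (mvec (Suc p) (K x) u) w = dot u (mvec (Suc p) (K x) w)"
proof -
  have "dot (mvec (Suc p) (K x) u) w = (\<Sum>i\<le>p. \<Sum>j\<le>p. K x i j * u j * w i)"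
    by (simp add: mvec_def sum_distrib_right lessThan_Suc_atMost)
  also have "\<dots> = (\<Sum>j\<le>p. \<Sum>i\<le>p. K x i j * u j * w i)"
    by (rule sum.swap)
  also have "\<dots> = (\<Sum>j\<le>p. \<Sum>i\<le>p. u j * (K x j i * w i))"
    using symmetric_K[OF assms] by (intro sum.cong refl) auto
  finally show ?thesis by (simp add: mvec_def sum_distrib_left lessThan_Suc_atMost)
qed

lemma eigenvectors_orthogonal:
  assumes "x \<in> unit_sphere p" "mvec (Suc p) (K x) u = (\<lambda>i. l * u i)" "mvec (Suc p) (K x) w = (\<lambda>i. \<mu> * w i)"
    and "l \<noteq> \<mu>"
  shows "dot u w = 0"
proof -
  have "l * dot u w = dot (mvec (Suc p) (K x) u) w"
    by (simp add: assms(2) sum_distrib_left mult.assoc)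
  also have "\<dots> = dot u (mvec (Suc p) (K x) w)"
    by (rule symmetric_dot[OF assms(1)])
  also have "\<dots> = \<mu> * dot u w"
    by (simp add: assms(3) sum_distrib_left mult.left_commute)
  finally show ?thesis using assms(4) by simp
qed

theorem K_eq_0:
  assumes x0: "x0 \<in> unit_sphere p" and "i0 \<le> p" "j0 \<le> p"
  shows "K x0 i0 j0 = 0"
proof (rule ccontr)
  assume nz: "K x0 i0 j0 \<noteq> 0"
  let ?m = "Suc p" and ?y = "\<lambda>i. - x0 i"
  obtain l \<mu> where ev: "l \<in> set rs" "\<mu> \<in> set rs" "l \<noteq> \<mu>" "l \<noteq> 0" "\<mu> \<noteq> 0"
    "has_eigenvector ?m (K x0) l" "has_eigenvector ?m (K x0) \<mu>"
    using two_nonzero_eigenvalues[OF symmetric_K[OF x0] trace_K[OF x0] annihilates_K[OF x0] distinct_rs _ _ nz]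
      assms(2,3) by (metis le_imp_less_Suc)
  obtain v where v: "\<And>i. continuous_on {x \<in> unit_sphere p. dot x x0 \<ge> -1/2} (\<lambda>x. v x i)"
    "\<And>x. x \<in> unit_sphere p \<Longrightarrow> dot x x0 \<ge> -1/2 \<Longrightarrow>
       supported ?m (v x) \<and> v x \<noteq> (\<lambda>i. 0) \<and> mvec ?m (K x) (v x) = (\<lambda>i. l * v x i)"
    using eigenvector_field[OF x0 ev(1,6)] by blast
  have y: "?y \<in> unit_sphere p" using x0 by (simp add: unit_sphere_def)
  \<comment> \<open>The family takes the same value at antipodal points, so \<open>\<mu>\<close> is
    an eigenvalue over \<open>-x0\<close> as well and the second field can start there.\<close>
  have "has_eigenvector ?m (K ?y) \<mu>" using ev(7) uminus_K[OF x0] by simp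
  from eigenvector_field[OF y ev(2) this]
  obtain w where w: "\<And>i. continuous_on {x \<in> unit_sphere p. dot x ?y \<ge> -1/2} (\<lambda>x. w x i)"
    "\<And>x. x \<in> unit_sphere p \<Longrightarrow> dot x ?y \<ge> -1/2 \<Longrightarrow>
       supported ?m (w x) \<and> w x \<noteq> (\<lambda>i. 0) \<and> mvec ?m (K x) (w x) = (\<lambda>i. \<mu> * w x i)"
    by blast
  \<comment> \<open>Each cut-off vanishes on the boundary of the cap carrying its field, and
    \<open>a x + b x = 1\<close>, so at every point at least one of them is positive.\<close>
  define a where "a = (\<lambda>x. dot x x0 + 1/2)"
  define b where "b = (\<lambda>x. 1/2 - dot x x0)"
  define f where "f = (\<lambda>x i. if a x \<ge> 0 then a x * v x i else 0)"
  define g where "g = (\<lambda>x i. if b x \<ge> 0 then b x * w x i else 0)"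
  have ab: "a x \<ge> 0 \<longleftrightarrow> dot x x0 \<ge> -1/2" "b x \<ge> 0 \<longleftrightarrow> dot x ?y \<ge> -1/2" for x
    by (auto simp: a_def b_def sum_negf)
  have v': "supported ?m (v x)" "v x \<noteq> (\<lambda>i. 0)" "mvec ?m (K x) (v x) = (\<lambda>i. l * v x i)"
    if "x \<in> unit_sphere p" "a x \<ge> 0" for x
    using v(2)[of x] that unfolding ab by auto
  have w': "supported ?m (w x)" "w x \<noteq> (\<lambda>i. 0)" "mvec ?m (K x) (w x) = (\<lambda>i. \<mu> * w x i)"
    if "x \<in> unit_sphere p" "b x \<ge> 0" for x
    using w(2)[of x] that unfolding ab by auto
  have "continuous_on (unit_sphere p) a" "continuous_on (unit_sphere p) b"
    unfolding a_def b_def by (intro continuous_intros continuous_on_id)+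
  then have cont: "continuous_on (unit_sphere p) (\<lambda>x i. f x i + g x i)"
    unfolding f_def g_def using v(1) w(1) unfolding ab[symmetric]
    by (intro continuous_on_coordinatewise_then_product continuous_on_add continuous_on_cutoff) auto
  have fg_supp: "f x i + g x i = 0" if "x \<in> unit_sphere p" "i > p" for x i
    using v'(1)[OF that(1)] w'(1)[OF that(1)] that(2) by (auto simp: f_def g_def supported_def)
  \<comment> \<open>The point \<open>x\<close> is itself an eigenvector for 0, so eigenvectors for
    the nonzero values \<open>l\<close> and \<open>\<mu>\<close> are orthogonal to it, that is,
    tangent to the sphere.\<close>
  have kernel: "mvec ?m (K x) x = (\<lambda>i. 0 * x i)" if "x \<in> unit_sphere p" for x
    using kernel_K[OF that] by (auto simp: mvec_def lessThan_Suc_atMost)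
  have dot_f: "dot (f x) u = (if a x \<ge> 0 then a x * dot (v x) u else 0)" for x u
    by (simp add: f_def sum_distrib_left mult.assoc)
  have dot_g: "dot (g x) u = (if b x \<ge> 0 then b x * dot (w x) u else 0)" for x u
    by (simp add: g_def sum_distrib_left mult.assoc)
  have "dot (f x) x = 0" "dot (g x) x = 0" if x: "x \<in> unit_sphere p" for x
    using eigenvectors_orthogonal[OF x v'(3)[OF x] kernel[OF x]]
      eigenvectors_orthogonal[OF x w'(3)[OF x] kernel[OF x]] ev(4,5)
    by (simp_all add: dot_f dot_g)
  then have "(\<Sum>i\<le>p. (f x i + g x i) * x i) = 0" if "x \<in> unit_sphere p" for x
    using that by (simp add: distrib_right sum.distrib)
  from hairy_ball[OF even_p cont fg_supp this]
  obtain x where x: "x \<in> unit_sphere p" and "\<And>i. f x i + g x i = 0" by auto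
  then have fg: "g x i = - f x i" for i by (simp add: add_eq_0_iff)
  \<comment> \<open>At a zero of the sum \<open>g x = - f x\<close>; orthogonality then makes the
    squared norm of \<open>f x\<close> zero, so both summands vanish, although one cut-off is
    positive.\<close>
  have "dot (f x) (g x) = 0"
  proof (cases "a x \<ge> 0 \<and> b x \<ge> 0")
    case True
    then have "dot (w x) (v x) = 0"
      using eigenvectors_orthogonal[OF x w'(3) v'(3)] x ev(3) by auto
    with True show ?thesis
      by (simp add: dot_f) (simp add: dot_g mult.commute[of "v x _"])
  next
    case False
    then show ?thesis by (auto simp: f_def g_def)
  qed
  then have "(\<Sum>i\<le>p. (f x i)\<^sup>2) = 0"
    by (simp add: fg power2_eq_square sum_negf)
  then have f0: "f x i = 0" if "i \<le> p" for i
    using that by (subst (asm) sum_nonneg_eq_0_iff) auto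
  have "a x + b x = 1" by (simp add: a_def b_def)
  then consider "a x > 0" | "b x > 0" by linarith
  then show False
  proof cases
    case 1
    then have "v x i = 0" for i
      using f0[of i] v'(1)[OF x] by (cases "i \<le> p") (auto simp: f_def supported_def)
    then show False using v'(2)[OF x] 1 by auto
  next
    case 2
    then have "w x i = 0" for i
      using f0[of i] fg[of i] w'(1)[OF x] by (cases "i \<le> p") (auto simp: g_def supported_def)
    then show False using w'(2)[OF x] 2 by auto
  qed
qed

end

section \<open>Trace-free curvature tensors in a pseudo-orthonormal frame\<close>

lemma sum_lessThan_split_0: "0 < m \<Longrightarrow> (\<Sum>k<m. f k) = f 0 + (\<Sum>k=1..<m. f k :: real)" for m :: nat
proof -
  assume "0 < m"
  then have "{..<m} = insert 0 {1..<m}" by auto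
  then show ?thesis by simp
qed

text \<open>The identity \<open>|B|\<^sup>2 = |A|\<^sup>2 - 2|Au|\<^sup>2 + (u\<^sup>T A u)\<^sup>2\<close> for the compression \<open>B\<close> of a symmetric
  matrix \<open>A\<close> to the orthogonal complement of a unit vector \<open>u\<close>, where \<open>s = -Au\<close> and \<open>\<alpha> = u\<^sup>T A u\<close>.\<close>

lemma frobenius_norm_compression:
  fixes A :: "'i \<Rightarrow> 'i \<Rightarrow> real"
  assumes u: "(\<Sum>i\<in>I. u i * u i) = 1"
    and row: "\<And>i. i \<in> I \<Longrightarrow> (\<Sum>j\<in>I. A i j * u j) = - s i"
    and col: "\<And>j. j \<in> I \<Longrightarrow> (\<Sum>i\<in>I. u i * A i j) = - s j"
    and us: "(\<Sum>i\<in>I. u i * s i) = - \<alpha>"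
  shows "(\<Sum>i\<in>I. \<Sum>j\<in>I. (A i j + u i * s j + s i * u j + \<alpha> * u i * u j)\<^sup>2) =
         (\<Sum>i\<in>I. \<Sum>j\<in>I. (A i j)\<^sup>2) - 2 * (\<Sum>i\<in>I. (s i)\<^sup>2) + \<alpha>\<^sup>2"
proof -
  define \<sigma> where "\<sigma> = (\<Sum>i\<in>I. (s i)\<^sup>2)"
  have inner: "(\<Sum>j\<in>I. (A i j + u i * s j + s i * u j + \<alpha> * u i * u j)\<^sup>2) =
      (\<Sum>j\<in>I. (A i j)\<^sup>2) + \<sigma> * (u i * u i) - (s i)\<^sup>2 - 2 * \<alpha> * (u i * s i) - \<alpha>\<^sup>2 * (u i * u i)
      + 2 * (\<Sum>j\<in>I. u i * A i j * s j)" if i: "i \<in> I" for i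
  proof -
    \<comment> \<open>With this grouping the base of the square is
      \<open>A i j + u i * s j + ?q * u j\<close>, and its expansion gives six sums over
      \<open>j\<close>.\<close>
    let ?q = "s i + \<alpha> * u i"
    have "(\<Sum>j\<in>I. (A i j + u i * s j + s i * u j + \<alpha> * u i * u j)\<^sup>2) =
        (\<Sum>j\<in>I. (A i j)\<^sup>2) + u i * u i * (\<Sum>j\<in>I. (s j)\<^sup>2) + ?q * ?q * (\<Sum>j\<in>I. u j * u j)
        + 2 * (\<Sum>j\<in>I. u i * A i j * s j) + 2 * ?q * (\<Sum>j\<in>I. A i j * u j) + 2 * (u i * ?q) * (\<Sum>j\<in>I. u j * s j)"
      unfolding sum_distrib_left sum.distrib[symmetric]
      by (intro sum.cong refl) (simp add: power2_eq_square algebra_simps)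
    then show ?thesis
      unfolding u row[OF i] us \<sigma>_def[symmetric] by (simp add: power2_eq_square algebra_simps)
  qed
  have "(\<Sum>i\<in>I. \<Sum>j\<in>I. u i * A i j * s j) = (\<Sum>j\<in>I. \<Sum>i\<in>I. u i * A i j * s j)"
    by (rule sum.swap)
  also have "\<dots> = (\<Sum>j\<in>I. (\<Sum>i\<in>I. u i * A i j) * s j)"
    by (simp add: sum_distrib_right)
  also have "\<dots> = - \<sigma>"
    by (simp add: col \<sigma>_def power2_eq_square sum_negf)
  finally have cross: "(\<Sum>i\<in>I. \<Sum>j\<in>I. u i * A i j * s j) = - \<sigma>" .
  have "(\<Sum>i\<in>I. \<Sum>j\<in>I. (A i j + u i * s j + s i * u j + \<alpha> * u i * u j)\<^sup>2) =
      (\<Sum>i\<in>I. \<Sum>j\<in>I. (A i j)\<^sup>2) + \<sigma> * (\<Sum>i\<in>I. u i * u i) - \<sigma> - 2 * \<alpha> * (\<Sum>i\<in>I. u i * s i)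
      - \<alpha>\<^sup>2 * (\<Sum>i\<in>I. u i * u i) + 2 * (\<Sum>i\<in>I. \<Sum>j\<in>I. u i * A i j * s j)"
    unfolding \<sigma>_def sum_distrib_left[of "2 * \<alpha>"] sum_distrib_left[of "\<alpha>\<^sup>2"] sum_distrib_left[of "sum _ _"] sum_distrib_left[of 2]
      sum.distrib[symmetric] sum_subtractf[symmetric]
    by (intro sum.cong refl) (simp add: inner \<sigma>_def sum_distrib_left)
  then show ?thesis
    unfolding u us cross by (simp add: \<sigma>_def power2_eq_square)
qed

text \<open>Components of the Weyl tensor in a pseudo-orthonormal frame with signs \<open>\<eta>\<close>.\<close>

locale weyl_frame =
  fixes m :: nat and \<eta> :: "nat \<Rightarrow> real" and F :: "nat \<Rightarrow> nat \<Rightarrow> nat \<Rightarrow> nat \<Rightarrow> real"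
  assumes m3: "m \<ge> 3"
    and anti: "\<And>a b c d. F a b c d = - F b a c d"
    and pair: "\<And>a b c d. F a b c d = F c d a b"
    and bianchi: "\<And>a b c d. F a b c d + F b c a d + F c a b d = 0"
    and tracefree: "\<And>a b. (\<Sum>k<m. \<eta> k * F a k k b) = 0"
begin

text \<open>These are the components \<open>W(e_a, x, x, e_b)\<close> of the Jacobi form; the Jacobi
  operator arises from it by raising an index, which brings in the sign
  \<open>\<eta>\<close>.\<close>

definition J :: "(nat \<Rightarrow> real) \<Rightarrow> nat \<Rightarrow> nat \<Rightarrow> real" where
  "J x a b = (\<Sum>c<m. \<Sum>d<m. x c * x d * F a c d b)"

text \<open>By symmetry of \<open>J x\<close> this is the trace of the square of the operator with
  matrix \<open>\<eta> a * J x a b\<close>.\<close>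

definition trace_J_sq :: "(nat \<Rightarrow> real) \<Rightarrow> real" where
  "trace_J_sq x = (\<Sum>a<m. \<Sum>b<m. \<eta> a * \<eta> b * (J x a b)\<^sup>2)"

lemma anti2: "F a b c d = - F a b d c"
  using anti[of c d a b] pair[of a b c d] pair[of a b d c] by simp

lemma F_repeat [simp]: "F a a c d = 0" "F a b c c = 0"
  using anti[of a a c d] anti2[of a b c c] by simp_all

text \<open>Skewness in the middle pair makes the three terms of the Bianchi identity equal, so
  three times the component is 0.\<close>

lemma F_eq_0_if_skew:
  assumes "F b c a d = - F b a c d" "F a c b d = - F a b c d"
  shows "F a b c d = 0"
  using assms bianchi[of a b c d] anti[of b a c d] anti[of c a b d] by simp

lemma J_sym: "J x a b = J x b a"
proof -
  have "F a c d b = F b d c a" for c d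
    using pair[of a c d b] anti[of d b a c] anti2[of b d a c] by simp
  then have "J x a b = (\<Sum>c<m. \<Sum>d<m. x d * x c * F b d c a)"
    unfolding J_def by (intro sum.cong refl) simp
  also have "\<dots> = J x b a" unfolding J_def by (rule sum.swap)
  finally show ?thesis .
qed

lemma J_self: "(\<Sum>b<m. J x a b * x b) = 0"
proof -
  let ?s = "\<lambda>c. \<Sum>d<m. \<Sum>b<m. x c * x d * x b * F a c d b"
  have "?s c = 0" for c
  proof -
    have "?s c = (\<Sum>b<m. \<Sum>d<m. x c * x d * x b * F a c d b)" by (rule sum.swap)
    also have "\<dots> = - ?s c"
      unfolding sum_negf[symmetric]
      by (intro sum.cong refl) (subst anti2, simp add: mult_ac)
    finally show ?thesis by simp
  qed
  moreover have "(\<Sum>b<m. J x a b * x b) = (\<Sum>b<m. \<Sum>c<m. \<Sum>d<m. x c * x d * x b * F a c d b)"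
    unfolding J_def by (simp add: sum_distrib_right sum_distrib_left mult_ac)
  moreover have "\<dots> = (\<Sum>c<m. \<Sum>b<m. \<Sum>d<m. x c * x d * x b * F a c d b)"
    by (rule sum.swap)
  moreover have "\<dots> = (\<Sum>c<m. ?s c)"
    by (intro sum.cong refl sum.swap)
  ultimately show ?thesis by simp
qed

text \<open>Antisymmetry in both pairs turns \<open>F a c d a\<close> into \<open>F c a a d\<close>,
  so the trace of the Jacobi operator is a contraction of the kind assumed to vanish.\<close>

lemma J_trace: "(\<Sum>a<m. \<eta> a * J x a a) = 0"
proof -
  have eq: "F a c d a = F c a a d" for a c d
    using anti[of a c d a] anti2[of c a d a] by simp
  have "(\<Sum>a<m. \<eta> a * J x a a) = (\<Sum>a<m. \<Sum>c<m. \<Sum>d<m. x c * x d * (\<eta> a * F c a a d))"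
    unfolding J_def sum_distrib_left by (intro sum.cong refl) (subst eq, simp add: mult_ac)
  also have "\<dots> = (\<Sum>c<m. \<Sum>a<m. \<Sum>d<m. x c * x d * (\<eta> a * F c a a d))"
    by (rule sum.swap)
  also have "\<dots> = (\<Sum>c<m. \<Sum>d<m. \<Sum>a<m. x c * x d * (\<eta> a * F c a a d))"
    by (intro sum.cong refl sum.swap)
  also have "\<dots> = (\<Sum>c<m. \<Sum>d<m. x c * x d * (\<Sum>a<m. \<eta> a * F c a a d))"
    by (simp add: sum_distrib_left)
  finally show ?thesis by (simp add: tracefree)
qed

lemma J_scale: "J (\<lambda>i. r * x i) a b = r\<^sup>2 * J x a b"
  unfolding J_def by (simp add: sum_distrib_left power2_eq_square mult_ac)

lemma continuous_on_J:
  fixes f :: "'b::topological_space \<Rightarrow> nat \<Rightarrow> real"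
  assumes "\<And>i. continuous_on S (\<lambda>t. f t i)"
  shows "continuous_on S (\<lambda>t. J (f t) a b)"
  unfolding J_def by (intro continuous_on_sum continuous_on_mult assms continuous_on_const)

text \<open>One expansion serves both signatures: \<open>\<alpha> = 0\<close> for unit vectors in
  the Riemannian case, \<open>p = 0\<close> and \<open>\<alpha> = 1\<close> for null vectors in the
  Lorentzian case.\<close>

lemma J_three:
  assumes "p < m" "k < m" "l < m"
  shows "J (\<lambda>c. \<alpha> * of_bool (c = p) + \<beta> * of_bool (c = k) + \<gamma> * of_bool (c = l)) a b =
    \<alpha> * (\<alpha> * F a p p b + \<beta> * F a p k b + \<gamma> * F a p l b) +
    \<beta> * (\<alpha> * F a k p b + \<beta> * F a k k b + \<gamma> * F a k l b) +
    \<gamma> * (\<alpha> * F a l p b + \<beta> * F a l k b + \<gamma> * F a l l b)"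
proof -
  let ?x = "\<lambda>c. \<alpha> * of_bool (c = p) + \<beta> * of_bool (c = k) + \<gamma> * of_bool (c = l) :: real"
  have ev: "(\<Sum>c<m. ?x c * f c) = \<alpha> * f p + \<beta> * f k + \<gamma> * f l" for f
  proof -
    have "(\<Sum>c<m. r * of_bool (c = q) * f c) = r * f q" if "q < m" for r :: real and q
      using that by (subst sum.remove[of _ q]) (auto intro!: sum.neutral)
    then show ?thesis using assms by (simp only: distrib_right sum.distrib)
  qed
  have "J ?x a b = (\<Sum>c<m. ?x c * (\<Sum>d<m. ?x d * F a c d b))"
    unfolding J_def by (simp only: sum_distrib_left mult.assoc)
  then show ?thesis by (simp only: ev)
qed

text \<open>Polarisation at \<open>e_k\<close>, \<open>e_l\<close> and their normalised sum gives
  skewness in the two middle indices.\<close>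

lemma F_eq_0_riemannian:
  assumes J0: "\<And>x i j. x \<in> unit_sphere (m - 1) \<Longrightarrow> i < m \<Longrightarrow> j < m \<Longrightarrow> J x i j = 0"
    and "a < m" "b < m" "c < m" "d < m"
  shows "F a b c d = 0"
proof -
  have sphere: "(\<lambda>c. 0 * of_bool (c = k) + \<beta> * of_bool (c = k) + \<gamma> * of_bool (c = l)) \<in> unit_sphere (m - 1)"
    if "k < m" "l < m" "k \<noteq> l" "\<beta>\<^sup>2 + \<gamma>\<^sup>2 = 1" for k l \<beta> \<gamma>
  proof -
    have "(\<Sum>i\<le>m-1. (0 * of_bool (i = k) + \<beta> * of_bool (i = k) + \<gamma> * of_bool (i = l))\<^sup>2) =
        (\<Sum>i\<in>{k, l}. (0 * of_bool (i = k) + \<beta> * of_bool (i = k) + \<gamma> * of_bool (i = l))\<^sup>2)"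
      using that by (intro sum.mono_neutral_right) auto
    then show ?thesis using that by (auto simp: unit_sphere_def)
  qed
  have skew: "F i k l j = - F i l k j" if "i < m" "j < m" "k < m" "l < m" for i j k l
  proof (cases "k = l")
    case False
    let ?r = "sqrt (1/2)"
    have r: "?r * ?r = 1/2" by simp
    have 1: "F i k k j = 0"
      using J0[OF sphere[of k l 1 0]] J_three[of k k l 0 1 0 i j] that False by simp
    have 2: "F i l l j = 0"
      using J0[OF sphere[of k l 0 1]] J_three[of k k l 0 0 1 i j] that False by simp
    have "?r * ?r * (F i k l j + F i l k j) = 0"
      using J0[OF sphere[of k l ?r ?r]] J_three[of k k l 0 ?r ?r i j] that False 1 2
      by (simp add: algebra_simps)
    then show ?thesis by (simp add: r)
  next
    \<comment> \<open>The auxiliary index is chosen different from \<open>k\<close> because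
      \<open>sphere\<close> asks for two distinct indices; its coefficient is 0.\<close>
    case True
    then show ?thesis
      using J0[OF sphere[of k "if k = 0 then 1 else 0" 1 0]] that m3
        J_three[of k k "if k = 0 then 1 else 0" 0 1 0 i j] by (simp split: if_splits)
  qed
  show ?thesis
    using assms by (intro F_eq_0_if_skew skew)
qed

context
  assumes eta_0: "\<eta> 0 = -1" and eta_spatial: "\<And>i. 0 < i \<Longrightarrow> i < m \<Longrightarrow> \<eta> i = 1"
begin

text \<open>The function is homogeneous of degree 4, hence equals \<open>C\<close> times the squared
  value of the metric on all spacelike vectors. The null vector is approached by
  \<open>e_0 + (1 + t) u\<close>, which is spacelike for \<open>t > 0\<close>, and both sides are
  continuous.\<close>

lemma trace_J_sq_null:
  assumes const: "\<And>x. (\<Sum>k<m. \<eta> k * (x k)\<^sup>2) = 1 \<Longrightarrow> trace_J_sq x = C"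
    and u0: "u 0 = 0" and u1: "(\<Sum>k=1..<m. u k * u k) = 1"
  shows "trace_J_sq (\<lambda>k. of_bool (k = 0) + u k) = 0"
proof -
  define x where "x = (\<lambda>t k. of_bool (k = 0) + (1 + t) * u k)"
  define f where "f = (\<lambda>t. trace_J_sq (x t) - C * ((1 + t)\<^sup>2 - 1)\<^sup>2)"
  have norm: "(\<Sum>k<m. \<eta> k * (x t k)\<^sup>2) = (1 + t)\<^sup>2 - 1" for t
  proof -
    have "(\<Sum>k=1..<m. \<eta> k * (x t k)\<^sup>2) = (\<Sum>k=1..<m. (1 + t)\<^sup>2 * (u k * u k))"
      by (intro sum.cong) (auto simp: x_def eta_spatial power_mult_distrib power2_eq_square)
    also have "\<dots> = (1 + t)\<^sup>2" by (simp only: u1 mult_1_right flip: sum_distrib_left)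
    finally show ?thesis using m3 by (simp add: sum_lessThan_split_0 eta_0 x_def u0)
  qed
  have zero: "f t = 0" if "t > 0" for t
  proof -
    define N where "N = (1 + t)\<^sup>2 - 1"
    have N: "N > 0" using that by (simp add: N_def power2_eq_square algebra_simps add_pos_pos)
    define r where "r = 1 / sqrt N"
    have r2: "r\<^sup>2 = 1 / N" using N by (simp add: r_def power_divide)
    have "(\<Sum>k<m. \<eta> k * (r * x t k)\<^sup>2) = r\<^sup>2 * (\<Sum>k<m. \<eta> k * (x t k)\<^sup>2)"
      by (simp add: sum_distrib_left power_mult_distrib mult_ac)
    also have "\<dots> = 1" using N by (simp add: norm r2 flip: N_def)
    finally have "C = trace_J_sq (\<lambda>k. r * x t k)" by (rule const[symmetric])
    also have "\<dots> = (r\<^sup>2)\<^sup>2 * trace_J_sq (x t)"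
      unfolding trace_J_sq_def J_scale power_mult_distrib by (simp add: sum_distrib_left mult_ac)
    finally show ?thesis using N by (simp add: f_def r2 power_divide flip: N_def)
  qed
  have "continuous_on UNIV f"
    unfolding f_def trace_J_sq_def x_def
    by (intro continuous_on_diff continuous_on_sum continuous_on_mult continuous_on_power
        continuous_on_J continuous_on_add continuous_on_const continuous_on_id)
  then have "(f \<longlongrightarrow> f 0) (at_right 0)"
    by (intro filterlim_at_split[THEN iffD1, THEN conjunct2]) (simp add: continuous_on_def)
  moreover have "(f \<longlongrightarrow> 0) (at_right 0)"
    by (rule tendsto_eventually) (use zero in \<open>auto simp: eventually_at_filter\<close>)
  ultimately have "f 0 = 0"
    by (rule tendsto_unique[rotated]) simp
  then show ?thesis by (simp add: f_def x_def)
qed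

text \<open>Because the form kills the null vector \<open>e_0 + u\<close>, its row 0 is determined
  by the spatial block. The trace of the square then collapses to the squared norm of the
  compression of that block to the complement of \<open>u\<close>, and a sum of squares equal to 0
  has zero terms. At indices with \<open>u i = u j = 0\<close> the compression has the entry
  \<open>S i j\<close>.\<close>

lemma J_null_eq_0:
  assumes const: "\<And>x. (\<Sum>k<m. \<eta> k * (x k)\<^sup>2) = 1 \<Longrightarrow> trace_J_sq x = C"
    and u0: "u 0 = 0" and u1: "(\<Sum>k=1..<m. u k * u k) = 1"
    and i: "i \<in> {1..<m}" "u i = 0" and j: "j \<in> {1..<m}" "u j = 0"
  shows "J (\<lambda>k. of_bool (k = 0) + u k) i j = 0"
proof -
  let ?I = "{1..<m}"
  define S where "S = J (\<lambda>k. of_bool (k = 0) + u k)"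
  have S_sym: "S a b = S b a" for a b unfolding S_def by (rule J_sym)
  have "(\<Sum>b<m. S a b * (of_bool (b = 0) + u b)) = 0" for a
    unfolding S_def by (rule J_self)
  then have "S a 0 + (\<Sum>b\<in>?I. S a b * (of_bool (b = 0) + u b)) = 0" for a
    using m3 by (simp add: sum_lessThan_split_0 u0)
  moreover have "(\<Sum>b\<in>?I. S a b * (of_bool (b = 0) + u b)) = (\<Sum>b\<in>?I. S a b * u b)" for a
    by (intro sum.cong) auto
  ultimately have row: "(\<Sum>b\<in>?I. S a b * u b) = - S 0 a" for a
    using S_sym[of a 0] by (simp add: add_eq_0_iff)
  then have col: "(\<Sum>b\<in>?I. u b * S b a) = - S 0 a" for a
    by (simp add: mult.commute S_sym[of _ a])
  have us: "(\<Sum>b\<in>?I. u b * S 0 b) = - S 0 0"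
    using row[of 0] by (simp add: mult.commute)
  have "(\<Sum>b<m. \<eta> a * \<eta> b * (S a b)\<^sup>2) = \<eta> a * (- (S a 0)\<^sup>2 + (\<Sum>b\<in>?I. (S a b)\<^sup>2))" for a
  proof -
    have "(\<Sum>b\<in>?I. \<eta> a * \<eta> b * (S a b)\<^sup>2) = (\<Sum>b\<in>?I. \<eta> a * (S a b)\<^sup>2)"
      by (intro sum.cong) (auto simp: eta_spatial)
    then show ?thesis
      using m3 by (simp add: sum_lessThan_split_0 eta_0 right_diff_distrib sum_distrib_left)
  qed
  then have "trace_J_sq (\<lambda>k. of_bool (k = 0) + u k) =
      (\<Sum>a<m. \<eta> a * (- (S a 0)\<^sup>2 + (\<Sum>b\<in>?I. (S a b)\<^sup>2)))"
    by (simp add: trace_J_sq_def S_def)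
  also have "\<dots> = (S 0 0)\<^sup>2 - (\<Sum>b\<in>?I. (S 0 b)\<^sup>2) + (\<Sum>a\<in>?I. - (S 0 a)\<^sup>2 + (\<Sum>b\<in>?I. (S a b)\<^sup>2))"
  proof -
    have "(\<Sum>a\<in>?I. \<eta> a * (- (S a 0)\<^sup>2 + (\<Sum>b\<in>?I. (S a b)\<^sup>2))) =
        (\<Sum>a\<in>?I. - (S 0 a)\<^sup>2 + (\<Sum>b\<in>?I. (S a b)\<^sup>2))"
      by (intro sum.cong refl, subst S_sym[of _ 0]) (simp add: eta_spatial)
    then show ?thesis using m3 by (simp add: sum_lessThan_split_0 eta_0)
  qed
  also have "\<dots> = (\<Sum>a\<in>?I. \<Sum>b\<in>?I. (S a b)\<^sup>2) - 2 * (\<Sum>a\<in>?I. (S 0 a)\<^sup>2) + (S 0 0)\<^sup>2"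
    by (simp add: sum.distrib sum_negf sum_subtractf)
  also have "\<dots> = (\<Sum>a\<in>?I. \<Sum>b\<in>?I. (S a b + u a * S 0 b + S 0 a * u b + S 0 0 * u a * u b)\<^sup>2)"
    by (rule frobenius_norm_compression[symmetric, OF u1 row col us])
  finally have "(\<Sum>a\<in>?I. \<Sum>b\<in>?I. (S a b + u a * S 0 b + S 0 a * u b + S 0 0 * u a * u b)\<^sup>2) = 0"
    using trace_J_sq_null[OF const u0 u1] by simp
  then have "\<forall>a\<in>?I. \<forall>b\<in>?I. (S a b + u a * S 0 b + S 0 a * u b + S 0 0 * u a * u b)\<^sup>2 = 0"
    by (simp add: sum_nonneg_eq_0_iff sum_nonneg)
  from this[rule_format, OF i(1) j(1)] i j show ?thesis by (simp add: S_def)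
qed

text \<open>Components with two indices 0 vanish by the trace condition, purely spatial ones by
  skewness in the middle pair, and those with a single 0 by a cyclic symmetry.\<close>

lemma F_eq_0_lorentzian:
  assumes const: "\<And>x. (\<Sum>k<m. \<eta> k * (x k)\<^sup>2) = 1 \<Longrightarrow> trace_J_sq x = C"
    and abcd: "a < m" "b < m" "c < m" "d < m"
  shows "F a b c d = 0"
proof -
  let ?I = "{1..<m}"
  \<comment> \<open>This is the vanishing of the Jacobi form at the null vector
    \<open>e_0 + \<beta> e_k + \<gamma> e_l\<close> on \<open>e_i\<close> and \<open>e_j\<close>;
    the side conditions say that the coordinates \<open>i\<close> and \<open>j\<close> of its
    spatial part are 0.\<close>
  have null: "F i 0 0 j + \<beta> * (F i 0 k j + F i k 0 j) + \<gamma> * (F i 0 l j + F i l 0 j)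
      + \<beta> * \<beta> * F i k k j + \<gamma> * \<gamma> * F i l l j + \<beta> * \<gamma> * (F i k l j + F i l k j) = 0"
    if "i \<in> ?I" "j \<in> ?I" "k \<in> ?I" "l \<in> ?I" "k \<noteq> l" "i \<noteq> k" "j \<noteq> k" "i \<noteq> l \<or> \<gamma> = 0" "j \<noteq> l \<or> \<gamma> = 0"
      "\<beta> * \<beta> + \<gamma> * \<gamma> = 1" for i j k l \<beta> \<gamma>
  proof -
    let ?u = "\<lambda>c. \<beta> * of_bool (c = k) + \<gamma> * of_bool (c = l)"
    have "(\<Sum>c\<in>?I. ?u c * ?u c) = (\<Sum>c\<in>{k, l}. ?u c * ?u c)"
      using that by (intro sum.mono_neutral_right) auto
    then have "(\<Sum>c\<in>?I. ?u c * ?u c) = 1" using that by simp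
    then have "J (\<lambda>c. of_bool (c = 0) + ?u c) i j = 0"
      using that by (intro J_null_eq_0[OF const]) auto
    then show ?thesis
      using J_three[of 0 k l 1 \<beta> \<gamma> i j] that by (simp add: add.assoc algebra_simps)
  qed
  have other: "\<exists>l\<in>?I. l \<noteq> k" for k
    using m3 by (intro bexI[of _ "if k = 1 then 2 else 1"]) auto
  \<comment> \<open>With \<open>\<gamma> = 0\<close>, the choices \<open>\<beta> = 1\<close> and
    \<open>\<beta> = -1\<close> separate the even and the odd part of \<open>null\<close>. The index
    \<open>l\<close> is a dummy; it exists because there are at least two spatial
    directions.\<close>
  have e1: "F i 0 0 j + F i k k j = 0" and e2: "F i 0 k j + F i k 0 j = 0"
    if h: "i \<in> ?I" "j \<in> ?I" "k \<in> ?I" "i \<noteq> k" "j \<noteq> k" for i j k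
  proof -
    obtain l where l: "l \<in> ?I" "k \<noteq> l" using other[of k] by auto
    show "F i 0 0 j + F i k k j = 0" "F i 0 k j + F i k 0 j = 0"
      using null[of i j k l 0 1] null[of i j k l 0 "-1"] h l by auto
  qed
  \<comment> \<open>By \<open>e1\<close> each spatial term of the contraction with \<open>k\<close>
    outside \<open>{i, j}\<close> is \<open>- F i 0 0 j\<close>, and the term for
    \<open>k = 0\<close> has the same sign, so a positive multiple of \<open>F i 0 0 j\<close> is
    0.\<close>
  have E0: "F i 0 0 j = 0" if ij: "i \<in> ?I" "j \<in> ?I" for i j
  proof -
    have "(\<Sum>k\<in>?I. \<eta> k * F i k k j) = (\<Sum>k\<in>?I. F i k k j)"
      by (intro sum.cong) (auto simp: eta_spatial)
    also have "\<dots> = (\<Sum>k\<in>?I - {i, j}. F i k k j)"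
      by (intro sum.mono_neutral_right) auto
    also have "\<dots> = (\<Sum>k\<in>?I - {i, j}. - F i 0 0 j)"
      using e1[OF ij] by (intro sum.cong) (auto simp: add_eq_0_iff)
    also have "\<dots> = - (real (card (?I - {i, j})) * F i 0 0 j)" by simp
    finally have "(1 + real (card (?I - {i, j}))) * F i 0 0 j = 0"
      using tracefree[of i j] m3 by (simp add: sum_lessThan_split_0 eta_0 algebra_simps)
    then show ?thesis by (simp add: add_nonneg_eq_0_iff)
  qed
  have kk: "F i k k j = 0" if "i \<in> ?I" "j \<in> ?I" "k \<in> ?I" for i j k
    using e1[of i j k] E0[of i j] that by (cases "i = k \<or> j = k") auto
  have skew: "F i k l j = - F i l k j" if h: "i \<in> ?I" "j \<in> ?I" "k \<in> ?I" "l \<in> ?I" for i j k l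
  proof -
    consider "k = l" | "i = k" | "i = l" | "j = k" | "j = l"
      | "k \<noteq> l" "i \<noteq> k" "i \<noteq> l" "j \<noteq> k" "j \<noteq> l" by blast
    then show ?thesis
    proof cases
      \<comment> \<open>Equal coefficients with squares summing to 1 leave only the mixed term of
        \<open>null\<close>, since the others cancel by \<open>e2\<close>, \<open>E0\<close> and
        \<open>kk\<close>.\<close>
      case 6
      let ?r = "sqrt (1/2)"
      have r: "?r * ?r = 1/2" by simp
      have "?r * ?r * (F i k l j + F i l k j) = 0"
        using null[of i j k l ?r ?r] e2[of i j k] e2[of i j l] 6 h kk E0
        by simp
      then show ?thesis by (simp add: r)
    qed (use kk h anti[of i l i j] anti[of i k i j] anti2[of i k l k] anti2[of i l k l] in auto)
  qed
  have F_I: "F i j k l = 0" if "i \<in> ?I" "j \<in> ?I" "k \<in> ?I" "l \<in> ?I" for i j k l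
    using that by (intro F_eq_0_if_skew skew)
  \<comment> \<open>In terms of the last three indices, \<open>e2\<close> is invariance under a
    cyclic shift. With skewness in the last pair this settles repeated indices; for distinct ones
    the Bianchi identity becomes three times the component.\<close>
  have T_cyc: "F 0 j i k = F 0 i k j" if "i \<in> ?I" "j \<in> ?I" "k \<in> ?I" "i \<noteq> k" "j \<noteq> k" for i j k
    using e2[of i j k] that anti[of i 0 k j] pair[of i k 0 j] by simp
  have T_bianchi: "F 0 i k j + F 0 k j i + F 0 j i k = 0" for i j k
    using bianchi[of j k i 0] pair[of j k i 0] pair[of k i j 0] pair[of i j k 0]
      anti[of i 0 j k] anti[of j 0 k i] anti[of k 0 i j] anti2[of 0 i j k] anti2[of 0 j k i] anti2[of 0 k i j] by simp
  have F_0: "F 0 i j k = 0" if h: "i \<in> ?I" "j \<in> ?I" "k \<in> ?I" for i j k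
  proof -
    consider "j = k" | "i = j" "i \<noteq> k" | "i = k" "i \<noteq> j" | "i \<noteq> j" "j \<noteq> k" "i \<noteq> k" by blast
    then show ?thesis
    proof cases
      case 2
      then show ?thesis using T_cyc[of i i k] h anti2[of 0 i i k] by simp
    next
      case 3
      then show ?thesis using T_cyc[of i i j] h anti2[of 0 i i j] by simp
    next
      case 4
      then show ?thesis using T_cyc[of j i k] T_cyc[of k j i] T_bianchi[of i j k] h by simp
    qed simp
  qed
  have F_1: "F i 0 j k = 0" "F j k 0 i = 0" "F j k i 0 = 0" if "i \<in> ?I" "j \<in> ?I" "k \<in> ?I" for i j k
    using F_0[OF that] anti[of i 0 j k] pair[of j k 0 i] pair[of j k i 0] by simp_all
  have F_2: "F 0 i j 0 = 0" "F 0 i 0 j = 0" "F i 0 j 0 = 0" if "i \<in> ?I" "j \<in> ?I" for i j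
    using E0[OF that] anti[of 0 i j 0] anti[of 0 i 0 j] anti2[of i 0 j 0] by simp_all
  have I: "x \<in> ?I" if "x < m" "x \<noteq> 0" for x using that by auto
  show ?thesis
    by (cases "a = 0"; cases "b = 0"; cases "c = 0"; cases "d = 0")
       (simp_all add: I abcd F_I F_0 F_1 F_2 E0)
qed

end

end

section \<open>Multilinear extension of a curvature-like tensor\<close>

locale curvature_like =
  fixes m :: nat and W :: "nat \<Rightarrow> nat \<Rightarrow> nat \<Rightarrow> nat \<Rightarrow> real"
  assumes W_anti: "\<And>a b c d. a < m \<Longrightarrow> b < m \<Longrightarrow> c < m \<Longrightarrow> d < m \<Longrightarrow> W a b c d = - W b a c d"
    and W_pair: "\<And>a b c d. a < m \<Longrightarrow> b < m \<Longrightarrow> c < m \<Longrightarrow> d < m \<Longrightarrow> W a b c d = W c d a b"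
    and W_bianchi: "\<And>a b c d. a < m \<Longrightarrow> b < m \<Longrightarrow> c < m \<Longrightarrow> d < m \<Longrightarrow>
       W a b c d + W b c a d + W c a b d = 0"
begin

text \<open>The nested form makes linearity in the first argument a single exchange of sums; the
  symmetries carry it to the other arguments.\<close>

definition W4 :: "(nat \<Rightarrow> real) \<Rightarrow> (nat \<Rightarrow> real) \<Rightarrow> (nat \<Rightarrow> real) \<Rightarrow> (nat \<Rightarrow> real) \<Rightarrow> real" where
  "W4 x y z w = (\<Sum>i<m. x i * (\<Sum>j<m. y j * (\<Sum>k<m. z k * (\<Sum>l<m. w l * W i j k l))))"

abbreviation basis :: "nat \<Rightarrow> nat \<Rightarrow> real" where
  "basis a \<equiv> \<lambda>i. if i = a then 1 else 0"

lemma W4_flat: "W4 x y z w = (\<Sum>i<m. \<Sum>j<m. \<Sum>k<m. \<Sum>l<m. x i * y j * z k * w l * W i j k l)"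
  by (simp add: W4_def sum_distrib_left mult_ac)

lemma W4_anti: "W4 x y z w = - W4 y x z w"
proof -
  have "W4 x y z w = (\<Sum>j<m. \<Sum>i<m. \<Sum>k<m. \<Sum>l<m. x i * y j * z k * w l * W i j k l)"
    unfolding W4_flat by (rule sum.swap)
  also have "\<dots> = (\<Sum>j<m. \<Sum>i<m. \<Sum>k<m. \<Sum>l<m. - (y j * x i * z k * w l * W j i k l))"
  proof (intro sum.cong refl)
    fix i j k l assume "j \<in> {..<m}" "i \<in> {..<m}" "k \<in> {..<m}" "l \<in> {..<m}"
    then show "x i * y j * z k * w l * W i j k l = - (y j * x i * z k * w l * W j i k l)"
      using W_anti[of i j k l] by simp
  qed
  also have "\<dots> = - W4 y x z w" unfolding W4_flat by (simp only: sum_negf)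
  finally show ?thesis .
qed

lemma W4_pair: "W4 x y z w = W4 z w x y"
proof -
  have "W4 x y z w = (\<Sum>i<m. \<Sum>k<m. \<Sum>j<m. \<Sum>l<m. x i * y j * z k * w l * W i j k l)"
    unfolding W4_flat by (intro sum.cong refl sum.swap)
  also have "\<dots> = (\<Sum>k<m. \<Sum>i<m. \<Sum>j<m. \<Sum>l<m. x i * y j * z k * w l * W i j k l)"
    by (rule sum.swap)
  also have "\<dots> = (\<Sum>k<m. \<Sum>i<m. \<Sum>l<m. \<Sum>j<m. x i * y j * z k * w l * W i j k l)"
    by (intro sum.cong refl sum.swap)
  also have "\<dots> = (\<Sum>k<m. \<Sum>l<m. \<Sum>i<m. \<Sum>j<m. x i * y j * z k * w l * W i j k l)"
    by (intro sum.cong refl sum.swap)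
  also have "\<dots> = (\<Sum>k<m. \<Sum>l<m. \<Sum>i<m. \<Sum>j<m. z k * w l * x i * y j * W k l i j)"
  proof (intro sum.cong refl)
    fix i j k l assume "k \<in> {..<m}" "l \<in> {..<m}" "i \<in> {..<m}" "j \<in> {..<m}"
    then show "x i * y j * z k * w l * W i j k l = z k * w l * x i * y j * W k l i j"
      using W_pair[of i j k l] by simp
  qed
  finally show ?thesis unfolding W4_flat .
qed

lemma W4_bianchi: "W4 x y z w + W4 y z x w + W4 z x y w = 0"
proof -
  have 1: "W4 y z x w = (\<Sum>i<m. \<Sum>j<m. \<Sum>k<m. \<Sum>l<m. x i * y j * z k * w l * W j k i l)"
  proof -
    have "W4 y z x w = (\<Sum>j<m. \<Sum>k<m. \<Sum>i<m. \<Sum>l<m. x i * y j * z k * w l * W j k i l)"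
      unfolding W4_flat by (intro sum.cong refl) simp
    also have "\<dots> = (\<Sum>j<m. \<Sum>i<m. \<Sum>k<m. \<Sum>l<m. x i * y j * z k * w l * W j k i l)"
      by (intro sum.cong refl sum.swap)
    also have "\<dots> = (\<Sum>i<m. \<Sum>j<m. \<Sum>k<m. \<Sum>l<m. x i * y j * z k * w l * W j k i l)"
      by (rule sum.swap)
    finally show ?thesis .
  qed
  have 2: "W4 z x y w = (\<Sum>i<m. \<Sum>j<m. \<Sum>k<m. \<Sum>l<m. x i * y j * z k * w l * W k i j l)"
  proof -
    have "W4 z x y w = (\<Sum>k<m. \<Sum>i<m. \<Sum>j<m. \<Sum>l<m. x i * y j * z k * w l * W k i j l)"
      unfolding W4_flat by (intro sum.cong refl) simp
    also have "\<dots> = (\<Sum>i<m. \<Sum>k<m. \<Sum>j<m. \<Sum>l<m. x i * y j * z k * w l * W k i j l)"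
      by (rule sum.swap)
    also have "\<dots> = (\<Sum>i<m. \<Sum>j<m. \<Sum>k<m. \<Sum>l<m. x i * y j * z k * w l * W k i j l)"
      by (intro sum.cong refl sum.swap)
    finally show ?thesis .
  qed
  have "W4 x y z w + W4 y z x w + W4 z x y w =
      (\<Sum>i<m. \<Sum>j<m. \<Sum>k<m. \<Sum>l<m. x i * y j * z k * w l * (W i j k l + W j k i l + W k i j l))"
    unfolding 1 2 W4_flat[of x y z w] by (simp only: sum.distrib[symmetric] distrib_left)
  also have "\<dots> = 0" by (simp add: W_bianchi)
  finally show ?thesis .
qed

lemma W4_linear_1: "W4 (\<lambda>i. \<Sum>c<n. s c * q c i) y z w = (\<Sum>c<n. s c * W4 (q c) y z w)"
proof -
  let ?f = "\<lambda>i. \<Sum>j<m. y j * (\<Sum>k<m. z k * (\<Sum>l<m. w l * W i j k l))"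
  have "W4 (\<lambda>i. \<Sum>c<n. s c * q c i) y z w = (\<Sum>i<m. \<Sum>c<n. s c * (q c i * ?f i))"
    unfolding W4_def sum_distrib_right by (simp only: mult.assoc)
  also have "\<dots> = (\<Sum>c<n. \<Sum>i<m. s c * (q c i * ?f i))" by (rule sum.swap)
  finally show ?thesis unfolding W4_def by (simp only: sum_distrib_left)
qed

lemma W4_linear_2: "W4 x (\<lambda>i. \<Sum>c<n. s c * q c i) z w = (\<Sum>c<n. s c * W4 x (q c) z w)"
  unfolding W4_anti[of x] W4_linear_1 by (simp add: sum_negf)

lemma W4_linear_3: "W4 x y (\<lambda>i. \<Sum>c<n. s c * q c i) w = (\<Sum>c<n. s c * W4 x y (q c) w)"
  unfolding W4_pair[of x y] W4_linear_1 ..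

lemma W4_cong_1: "(\<And>i. i < m \<Longrightarrow> x i = x' i) \<Longrightarrow> W4 x y z w = W4 x' y z w"
  unfolding W4_def by (intro sum.cong) auto

lemma sum_basis: "a < m \<Longrightarrow> (\<Sum>i<m. basis a i * f i) = f a"
  by (simp add: if_distrib[of "\<lambda>x. x * _"] cong: if_cong)

lemma W4_basis: "a < m \<Longrightarrow> b < m \<Longrightarrow> c < m \<Longrightarrow> d < m \<Longrightarrow> W4 (basis a) (basis b) (basis c) (basis d) = W a b c d"
  unfolding W4_def by (simp only: sum_basis)

lemma W4_basis_1_4:
  "b < m \<Longrightarrow> c < m \<Longrightarrow> W4 (basis b) x x (basis c) = (\<Sum>a<m. \<Sum>d<m. x a * x d * W b a d c)"
  unfolding W4_def by (simp only: sum_basis) (simp add: sum_distrib_left mult_ac)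

lemma W4_basis_2_3:
  "i < m \<Longrightarrow> j < m \<Longrightarrow> W4 x (basis i) (basis j) y = (\<Sum>s<m. \<Sum>t<m. x s * y t * W s i j t)"
  unfolding W4_def by (simp only: sum_basis) (simp add: sum_distrib_left mult_ac)

lemma expand_basis: "i < m \<Longrightarrow> x i = (\<Sum>c<m. x c * basis c i)"
  by (simp add: if_distrib[of "\<lambda>y. _ * y"] cong: if_cong)

lemma W4_expand_1: "W4 x y z w = (\<Sum>c<m. x c * W4 (basis c) y z w)"
proof -
  have "W4 x y z w = W4 (\<lambda>i. \<Sum>c<m. x c * basis c i) y z w"
    by (rule W4_cong_1) (rule expand_basis)
  then show ?thesis by (simp only: W4_linear_1)
qed

lemma W4_expand_2: "W4 x y z w = (\<Sum>c<m. y c * W4 x (basis c) z w)"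
  unfolding W4_anti[of x] by (subst W4_expand_1) (simp add: sum_negf)

lemma W4_expand_3: "W4 x y z w = (\<Sum>c<m. z c * W4 x y (basis c) w)"
  unfolding W4_pair[of x y] by (rule W4_expand_1)

lemma W4_expand_4: "W4 x y z w = (\<Sum>c<m. w c * W4 x y z (basis c))"
  unfolding W4_pair[of x y] by (rule W4_expand_2)

text \<open>The matrix \<open>q\<close> writes coordinate vectors in terms of the frame. Frame
  arguments are exchanged for coordinate vectors one at a time, always in the first slot, to which
  the symmetries bring the next argument.\<close>

lemma W_eq_0_if_frame_components_eq_0:
  assumes inv: "\<And>i j. i < m \<Longrightarrow> j < m \<Longrightarrow> (\<Sum>a<m. q j a * p a i) = basis j i"
    and zero: "\<And>a b c d. a < m \<Longrightarrow> b < m \<Longrightarrow> c < m \<Longrightarrow> d < m \<Longrightarrow> W4 (p a) (p b) (p c) (p d) = 0"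
    and "a < m" "b < m" "c < m" "d < m"
  shows "W a b c d = 0"
proof -
  have step: "W4 (basis j) y z w = 0" if "\<And>a. a < m \<Longrightarrow> W4 (p a) y z w = 0" "j < m" for j y z w
  proof -
    have "W4 (basis j) y z w = W4 (\<lambda>i. \<Sum>a<m. q j a * p a i) y z w"
      by (rule W4_cong_1) (simp add: inv that)
    then show ?thesis by (simp add: W4_linear_1 that)
  qed
  have 1: "W4 (basis a) (p b) (p c) (p d) = 0" if "a < m" "b < m" "c < m" "d < m" for a b c d
    by (rule step) (use that zero in auto)
  have 2: "W4 (basis b) (basis a) (p c) (p d) = 0" if "a < m" "b < m" "c < m" "d < m" for a b c d
    by (rule step) (use that 1 W4_anti[of _ "basis a"] in auto)
  have 3: "W4 (basis c) (p d) (basis a) (basis b) = 0" if "a < m" "b < m" "c < m" "d < m" for a b c d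
    by (rule step) (use that 2 W4_pair[of _ _ "basis a" "basis b"] in auto)
  have "W4 (basis d) (basis c) (basis a) (basis b) = 0" if "a < m" "b < m" "c < m" "d < m" for a b c d
    by (rule step) (use that 3 W4_anti[of _ "basis c"] in auto)
  from this[of c d b a] assms show ?thesis by (simp add: W4_basis)
qed

end

section \<open>The Weyl tensor of a metric in a pseudo-orthonormal frame\<close>

locale pseudo_orthonormal_frame =
  fixes m :: nat and G :: "real mat" and R :: "nat \<Rightarrow> nat \<Rightarrow> nat \<Rightarrow> nat \<Rightarrow> real"
    and P :: "real mat" and \<eta> :: "nat \<Rightarrow> real"
  assumes m3: "m \<ge> 3" and curv: "alg_curv_tensor m R"
    and G: "G \<in> carrier_mat m m" and G_transpose: "G\<^sup>T = G" and P: "P \<in> carrier_mat m m"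
    and frame: "P\<^sup>T * G * P = mat m m (\<lambda>(i,j). if i = j then \<eta> i else 0)"
    and eta_sq: "\<And>i. i < m \<Longrightarrow> \<eta> i * \<eta> i = 1"
begin

definition D :: "real mat" where
  "D = mat m m (\<lambda>(i,j). if i = j then \<eta> i else 0)"

text \<open>This is the inverse of \<open>P\<close>: the frame condition reads
  \<open>P\<^sup>T * G * P = D\<close>, and \<open>D\<close> is its own inverse.\<close>

definition Q :: "real mat" where
  "Q = D * P\<^sup>T * G"

lemma D_carrier [simp]: "D \<in> carrier_mat m m" by (simp add: D_def)

lemma mult_carrier_square [simp]: "A \<in> carrier_mat m m \<Longrightarrow> B \<in> carrier_mat m m \<Longrightarrow> A * B \<in> carrier_mat m m"
  by (rule mult_carrier_mat)

lemma P_transpose_carrier [simp]: "P\<^sup>T \<in> carrier_mat m m" using P by simp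

lemma Q_carrier [simp]: "Q \<in> carrier_mat m m" using G P by (simp add: Q_def)

lemma mult_D: "A \<in> carrier_mat m m \<Longrightarrow> A * D = mat m m (\<lambda>(i,j). A $$ (i,j) * \<eta> j)"
  by (rule eq_matI) (auto simp: D_def scalar_prod_def if_distrib sum.delta cong: if_cong)

lemma D_D: "D * D = 1\<^sub>m m"
  by (simp only: mult_D[OF D_carrier]) (rule eq_matI, auto simp: D_def eta_sq)

lemma Q_P: "Q * P = 1\<^sub>m m"
proof -
  have "Q * P = D * (P\<^sup>T * G * P)"
    using G P by (simp add: Q_def assoc_mult_mat[of _ m m _ m _ m])
  then show ?thesis unfolding frame by (simp add: D_D flip: D_def)
qed

lemma P_Q: "P * Q = 1\<^sub>m m"
  by (rule mat_mult_left_right_inverse[OF Q_carrier P Q_P])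

lemma ginv_eq: "ginv G = P * D * P\<^sup>T"
proof -
  let ?B = "P * D * P\<^sup>T"
  have B: "?B \<in> carrier_mat m m" using P by simp
  have BG: "?B * G = 1\<^sub>m m"
    using P_Q G P by (simp add: Q_def assoc_mult_mat[of _ m m _ m _ m])
  have GB: "G * ?B = 1\<^sub>m m"
    by (rule mat_mult_left_right_inverse[OF B G BG])
  \<comment> \<open>\<open>mat_inverse\<close> returns \<open>None\<close> only for matrices that
    are not units, so an explicit inverse forces a value, which then agrees with \<open>?B\<close>
    by uniqueness of inverses.\<close>
  have "G \<in> Units (ring_mat TYPE(real) m ())"
    unfolding Units_def using B BG GB G by (auto simp: ring_mat_def)
  then obtain C where C: "mat_inverse G = Some C"
    using mat_inverse(1)[OF G, of "()"] by (cases "mat_inverse G") auto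
  from mat_inverse(2)[OF G C] have GC: "G * C = 1\<^sub>m m" "C \<in> carrier_mat m m" by auto
  have "?B = ?B * (G * C)" unfolding GC(1) by (rule right_mult_one_mat[OF B, symmetric])
  also have "\<dots> = ?B * G * C" by (rule assoc_mult_mat[OF B G GC(2), symmetric])
  also have "\<dots> = C" unfolding BG by (rule left_mult_one_mat[OF GC(2)])
  finally show ?thesis by (simp add: ginv_def C)
qed

lemma ginv_carrier: "ginv G \<in> carrier_mat m m"
  using P by (simp add: ginv_eq)

lemma ginv_G: "ginv G * G = 1\<^sub>m m"
  using P_Q G P by (simp add: ginv_eq Q_def assoc_mult_mat[of _ m m _ m _ m])

lemma ginv_entry: "i < m \<Longrightarrow> j < m \<Longrightarrow> ginv G $$ (i,j) = (\<Sum>k<m. \<eta> k * (P $$ (i,k) * P $$ (j,k)))"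
  using P by (auto simp: ginv_eq mult_D scalar_prod_def atLeast0LessThan mult_ac intro!: sum.cong)

lemma ginv_sym: "i < m \<Longrightarrow> j < m \<Longrightarrow> ginv G $$ (i,j) = ginv G $$ (j,i)"
  by (simp add: ginv_entry mult_ac)

lemma G_sym: "i < m \<Longrightarrow> j < m \<Longrightarrow> G $$ (i,j) = G $$ (j,i)"
  using G G_transpose by (metis carrier_matD index_transpose_mat(1))

lemma sum_ginv_G: "i < m \<Longrightarrow> k < m \<Longrightarrow> (\<Sum>j<m. ginv G $$ (i,j) * G $$ (j,k)) = (if i = k then 1 else 0)"
  using arg_cong[OF ginv_G, of "\<lambda>A. A $$ (i,k)"] ginv_carrier G
  by (simp add: scalar_prod_def atLeast0LessThan)

lemma sum_P_Q: "i < m \<Longrightarrow> j < m \<Longrightarrow> (\<Sum>a<m. Q $$ (a,j) * P $$ (i,a)) = (if i = j then 1 else 0)"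
  using arg_cong[OF P_Q, of "\<lambda>A. A $$ (i,j)"] P carrier_matD[OF Q_carrier]
  by (simp add: scalar_prod_def atLeast0LessThan mult.commute)

lemma R_anti: "a < m \<Longrightarrow> b < m \<Longrightarrow> c < m \<Longrightarrow> d < m \<Longrightarrow> R a b c d = - R b a c d"
  and R_pair: "a < m \<Longrightarrow> b < m \<Longrightarrow> c < m \<Longrightarrow> d < m \<Longrightarrow> R a b c d = R c d a b"
  and R_bianchi: "a < m \<Longrightarrow> b < m \<Longrightarrow> c < m \<Longrightarrow> d < m \<Longrightarrow> R a b c d + R b c a d + R c a b d = 0"
  using curv unfolding alg_curv_tensor_def by blast+

lemma ricci_sym: "a < m \<Longrightarrow> b < m \<Longrightarrow> ricci m G R a b = ricci m G R b a"
proof -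
  assume ab: "a < m" "b < m"
  have "ricci m G R a b = (\<Sum>j<m. \<Sum>i<m. ginv G $$ (i,j) * R a i j b)"
    unfolding ricci_def by (rule sum.swap)
  also have "\<dots> = (\<Sum>j<m. \<Sum>i<m. ginv G $$ (j,i) * R b j i a)"
  proof (intro sum.cong refl)
    fix i j assume "j \<in> {..<m}" "i \<in> {..<m}"
    then show "ginv G $$ (i,j) * R a i j b = ginv G $$ (j,i) * R b j i a"
      using ginv_sym[of i j] R_pair[of a i j b] R_anti[of j b a i] R_pair[of b j a i]
        R_anti[of a i b j] R_pair[of i a b j] ab by simp
  qed
  finally show ?thesis unfolding ricci_def .
qed

sublocale curvature_like m "weyl m G R"
proof
  fix a b c d assume h: "a < m" "b < m" "c < m" "d < m"
  note sy = G_sym[of a b] G_sym[of a c] G_sym[of a d] G_sym[of b c] G_sym[of b d] G_sym[of c d]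
    ricci_sym[of a b] ricci_sym[of a c] ricci_sym[of a d] ricci_sym[of b c] ricci_sym[of b d] ricci_sym[of c d]
  show "weyl m G R a b c d = - weyl m G R b a c d"
    unfolding weyl_def using R_anti[OF h] by (simp add: algebra_simps)
  show "weyl m G R a b c d = weyl m G R c d a b"
    unfolding weyl_def using R_pair[OF h] sy h by (simp add: algebra_simps)
  define x where "x = 1 / (real m - 2)"
  define y where "y = scal m G R / ((real m - 1) * (real m - 2))"
  show "weyl m G R a b c d + weyl m G R b c a d + weyl m G R c a b d = 0"
    unfolding weyl_def x_def[symmetric] y_def[symmetric]
    using R_bianchi[OF h] sy h by (simp add: algebra_simps)
qed

text \<open>After contraction the Ricci tensor has the coefficient \<open>1 - x * (m - 2)\<close>
  and the metric the coefficient \<open>y * (m - 1) - ?\<tau> * x\<close>; the constants in the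
  definition of the Weyl tensor make both 0.\<close>

lemma weyl_tracefree:
  assumes "a < m" "b < m"
  shows "(\<Sum>i<m. \<Sum>j<m. ginv G $$ (i,j) * weyl m G R a i j b) = 0"
proof -
  let ?g = "\<lambda>i j. ginv G $$ (i,j)" and ?\<rho> = "ricci m G R" and ?\<tau> = "scal m G R"
  define x where "x = 1 / (real m - 2)"
  define y where "y = ?\<tau> / ((real m - 1) * (real m - 2))"
  have delta: "(\<Sum>i<m. (if i = b then 1 else 0) * f i) = f b" "(\<Sum>i<m. (if b = i then 1 else 0) * f i) = f b"
    if "b < m" for f :: "nat \<Rightarrow> real" and b
    using that by (simp_all add: if_distrib[of "\<lambda>x. x * _"] cong: if_cong)
  have gG: "(\<Sum>i<m. ?g i j * G $$ (i,k)) = (if j = k then 1 else 0)" if "j < m" "k < m" for j k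
    using sum_ginv_G[OF that] ginv_sym[OF _ that(1)] by (simp cong: sum.cong_simp)
  have t1: "(\<Sum>i<m. \<Sum>j<m. ?g i j * G $$ (i,j)) = real m"
  proof -
    have "(\<Sum>j<m. ?g i j * G $$ (i,j)) = 1" if "i < m" for i
      using sum_ginv_G[OF that that] G_sym[OF that] by (simp cong: sum.cong_simp)
    then show ?thesis by simp
  qed
  have t2: "(\<Sum>i<m. \<Sum>j<m. ?g i j * (f j * G $$ (i,b))) = f b" for f :: "nat \<Rightarrow> real"
  proof -
    have "(\<Sum>i<m. \<Sum>j<m. ?g i j * (f j * G $$ (i,b))) = (\<Sum>j<m. \<Sum>i<m. ?g i j * (f j * G $$ (i,b)))"
      by (rule sum.swap)
    also have "\<dots> = (\<Sum>j<m. (\<Sum>i<m. ?g i j * G $$ (i,b)) * f j)"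
      by (simp add: sum_distrib_right sum_distrib_left mult_ac)
    also have "\<dots> = (\<Sum>j<m. (if j = b then 1 else 0) * f j)"
      using assms by (intro sum.cong refl) (simp add: gG)
    finally show ?thesis using assms delta by simp
  qed
  have t3: "(\<Sum>i<m. \<Sum>j<m. ?g i j * (G $$ (a,j) * f i)) = f a" for f :: "nat \<Rightarrow> real"
  proof -
    have "(\<Sum>i<m. \<Sum>j<m. ?g i j * (G $$ (a,j) * f i)) = (\<Sum>i<m. (\<Sum>j<m. ?g i j * G $$ (j,a)) * f i)"
      unfolding sum_distrib_right using assms by (intro sum.cong refl) (simp add: G_sym)
    also have "\<dots> = (\<Sum>i<m. (if i = a then 1 else 0) * f i)"
      using assms by (intro sum.cong refl) (simp add: sum_ginv_G)
    finally show ?thesis using assms delta by simp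
  qed
  have "(\<Sum>i<m. \<Sum>j<m. ?g i j * weyl m G R a i j b) =
      (\<Sum>i<m. \<Sum>j<m. ?g i j * R a i j b)
      - x * (?\<rho> a b * (\<Sum>i<m. \<Sum>j<m. ?g i j * G $$ (i,j)) + G $$ (a,b) * (\<Sum>i<m. \<Sum>j<m. ?g i j * ?\<rho> i j))
      + x * ((\<Sum>i<m. \<Sum>j<m. ?g i j * (?\<rho> a j * G $$ (i,b))) + (\<Sum>i<m. \<Sum>j<m. ?g i j * (G $$ (a,j) * ?\<rho> i b)))
      + y * (G $$ (a,b) * (\<Sum>i<m. \<Sum>j<m. ?g i j * G $$ (i,j)) - (\<Sum>i<m. \<Sum>j<m. ?g i j * (G $$ (a,j) * G $$ (i,b))))"
    unfolding sum_distrib_left sum.distrib[symmetric] sum_subtractf[symmetric]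
    by (intro sum.cong refl) (simp add: weyl_def x_def y_def algebra_simps)
  also have "\<dots> = ?\<rho> a b - x * (?\<rho> a b * real m + G $$ (a,b) * ?\<tau>) + x * (?\<rho> a b + ?\<rho> a b)
      + y * (G $$ (a,b) * real m - G $$ (a,b))"
    unfolding t1 t2 t3 by (simp add: ricci_def scal_def)
  also have "\<dots> = 0"
  proof -
    have "x * (real m - 2) = 1" "y * (real m - 1) = ?\<tau> * x"
      using m3 by (simp_all add: x_def y_def)
    moreover have "?\<rho> a b - x * (?\<rho> a b * real m + G $$ (a,b) * ?\<tau>) + x * (?\<rho> a b + ?\<rho> a b)
        + y * (G $$ (a,b) * real m - G $$ (a,b)) =
        ?\<rho> a b * (1 - x * (real m - 2)) + G $$ (a,b) * (y * (real m - 1) - ?\<tau> * x)"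
      by (simp add: algebra_simps)
    ultimately show ?thesis by simp
  qed
  finally show ?thesis .
qed

abbreviation p :: "nat \<Rightarrow> nat \<Rightarrow> real" where
  "p a \<equiv> \<lambda>i. P $$ (i,a)"

text \<open>The signed sum of the products \<open>p k i * p k j\<close> is the inverse metric, so
  the trace over the frame is the metric contraction.\<close>

lemma frame_tracefree: "(\<Sum>k<m. \<eta> k * W4 x (p k) (p k) y) = 0"
proof -
  have "W4 x (p k) (p k) y = (\<Sum>i<m. \<Sum>j<m. p k i * p k j * W4 x (basis i) (basis j) y)" for k
    by (subst W4_expand_2, subst W4_expand_3) (simp add: sum_distrib_left mult.assoc)
  then have "(\<Sum>k<m. \<eta> k * W4 x (p k) (p k) y) =
      (\<Sum>k<m. \<Sum>i<m. \<Sum>j<m. \<eta> k * (p k i * p k j) * W4 x (basis i) (basis j) y)"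
    by (simp add: sum_distrib_left mult.assoc)
  also have "\<dots> = (\<Sum>i<m. \<Sum>k<m. \<Sum>j<m. \<eta> k * (p k i * p k j) * W4 x (basis i) (basis j) y)"
    by (rule sum.swap)
  also have "\<dots> = (\<Sum>i<m. \<Sum>j<m. \<Sum>k<m. \<eta> k * (p k i * p k j) * W4 x (basis i) (basis j) y)"
    by (intro sum.cong refl sum.swap)
  also have "\<dots> = (\<Sum>i<m. \<Sum>j<m. ginv G $$ (i,j) * W4 x (basis i) (basis j) y)"
    by (intro sum.cong refl) (simp add: ginv_entry sum_distrib_right)
  also have "\<dots> = (\<Sum>i<m. \<Sum>j<m. \<Sum>s<m. \<Sum>t<m. x s * y t * (ginv G $$ (i,j) * weyl m G R s i j t))"
    by (intro sum.cong refl) (simp add: W4_basis_2_3 sum_distrib_left mult_ac)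
  also have "\<dots> = (\<Sum>i<m. \<Sum>s<m. \<Sum>j<m. \<Sum>t<m. x s * y t * (ginv G $$ (i,j) * weyl m G R s i j t))"
    by (intro sum.cong refl sum.swap)
  also have "\<dots> = (\<Sum>s<m. \<Sum>i<m. \<Sum>j<m. \<Sum>t<m. x s * y t * (ginv G $$ (i,j) * weyl m G R s i j t))"
    by (rule sum.swap)
  also have "\<dots> = (\<Sum>s<m. \<Sum>i<m. \<Sum>t<m. \<Sum>j<m. x s * y t * (ginv G $$ (i,j) * weyl m G R s i j t))"
    by (intro sum.cong refl sum.swap)
  also have "\<dots> = (\<Sum>s<m. \<Sum>t<m. \<Sum>i<m. \<Sum>j<m. x s * y t * (ginv G $$ (i,j) * weyl m G R s i j t))"
    by (intro sum.cong refl sum.swap)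
  also have "\<dots> = (\<Sum>s<m. \<Sum>t<m. x s * y t * (\<Sum>i<m. \<Sum>j<m. ginv G $$ (i,j) * weyl m G R s i j t))"
    by (simp only: sum_distrib_left)
  also have "\<dots> = 0" by (simp add: weyl_tracefree)
  finally show ?thesis .
qed

text \<open>The symmetries hold for all indices, even from \<open>m\<close> on, because
  \<open>W4\<close> has them for arbitrary arguments.\<close>

sublocale fr: weyl_frame m \<eta> "\<lambda>a b c d. W4 (p a) (p b) (p c) (p d)"
proof
  show "3 \<le> m" by (rule m3)
next
  fix a b c d
  show "W4 (p a) (p b) (p c) (p d) = - W4 (p b) (p a) (p c) (p d)" by (rule W4_anti)
  show "W4 (p a) (p b) (p c) (p d) = W4 (p c) (p d) (p a) (p b)" by (rule W4_pair)
  show "W4 (p a) (p b) (p c) (p d) + W4 (p b) (p c) (p a) (p d) + W4 (p c) (p a) (p b) (p d) = 0"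
    by (rule W4_bianchi)
next
  fix a b show "(\<Sum>k<m. \<eta> k * W4 (p a) (p k) (p k) (p b)) = 0" by (rule frame_tracefree)
qed

lemma weyl_vanishes_if_frame_vanishes:
  assumes "\<And>a b c d. a < m \<Longrightarrow> b < m \<Longrightarrow> c < m \<Longrightarrow> d < m \<Longrightarrow> W4 (p a) (p b) (p c) (p d) = 0"
  shows "weyl_vanishes_at m G R"
  unfolding weyl_vanishes_at_def
proof (intro allI impI)
  fix a b c d assume h: "a < m" "b < m" "c < m" "d < m"
  show "weyl m G R a b c d = 0"
    by (rule W_eq_0_if_frame_components_eq_0[of "\<lambda>j a. Q $$ (a,j)" p, OF sum_P_Q assms h])
qed

end

section \<open>Similarity of Jacobi operators and the two signatures\<close>

lemma trace_mult_commute: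
  fixes A B :: "'a::comm_ring_1 mat"
  assumes "A \<in> carrier_mat m m" "B \<in> carrier_mat m m"
  shows "(\<Sum>i<m. (A * B) $$ (i,i)) = (\<Sum>i<m. (B * A) $$ (i,i))"
proof -
  have "(\<Sum>i<m. (A * B) $$ (i,i)) = (\<Sum>i<m. \<Sum>k<m. A $$ (i,k) * B $$ (k,i))"
    using assms by (intro sum.cong refl) (simp add: scalar_prod_def atLeast0LessThan)
  also have "\<dots> = (\<Sum>k<m. \<Sum>i<m. A $$ (i,k) * B $$ (k,i))" by (rule sum.swap)
  also have "\<dots> = (\<Sum>k<m. (B * A) $$ (k,k))"
    using assms by (intro sum.cong refl) (simp add: scalar_prod_def atLeast0LessThan mult.commute)
  finally show ?thesis .
qed

lemma trace_square_similar:
  fixes A B :: "'a::comm_ring_1 mat"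
  assumes "similar_mat A B" and A: "A \<in> carrier_mat m m"
  shows "(\<Sum>i<m. (A * A) $$ (i,i)) = (\<Sum>i<m. (B * B) $$ (i,i))"
proof -
  obtain P Q where "similar_mat_wit A B P Q" using assms(1) by (auto simp: similar_mat_def)
  from similar_mat_witD2[OF A this] have w: "Q * P = 1\<^sub>m m" "A = P * B * Q"
    and c: "B \<in> carrier_mat m m" "P \<in> carrier_mat m m" "Q \<in> carrier_mat m m" by auto
  have BB: "B * B \<in> carrier_mat m m" and BBQ: "B * B * Q \<in> carrier_mat m m"
    and BQ: "B * Q \<in> carrier_mat m m"
    using c by (auto intro!: mult_carrier_mat[of _ m m])
  have "A * A = P * (B * Q) * (P * (B * Q))"
    unfolding w(2) using c by (simp add: assoc_mult_mat[of _ m m _ m _ m])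
  also have "\<dots> = P * (B * Q * (P * (B * Q)))"
    using c BQ by (intro assoc_mult_mat[of _ m m _ m _ m]) (auto intro!: mult_carrier_mat[of _ m m])
  also have "B * Q * (P * (B * Q)) = B * (Q * (P * (B * Q)))"
    using c BQ by (intro assoc_mult_mat[of _ m m _ m _ m]) (auto intro!: mult_carrier_mat[of _ m m])
  also have "Q * (P * (B * Q)) = Q * P * (B * Q)"
    using c BQ by (intro assoc_mult_mat[of _ m m _ m _ m, symmetric]) auto
  also have "\<dots> = B * Q" unfolding w(1) by (rule left_mult_one_mat[OF BQ])
  also have "B * (B * Q) = B * B * Q"
    using c by (intro assoc_mult_mat[of _ m m _ m _ m, symmetric]) auto
  finally have "(\<Sum>i<m. (A * A) $$ (i,i)) = (\<Sum>i<m. (P * (B * B * Q)) $$ (i,i))" by simp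
  also have "\<dots> = (\<Sum>i<m. (B * B * Q * P) $$ (i,i))"
    by (rule trace_mult_commute[OF c(2) BBQ])
  also have "B * B * Q * P = B * B * (Q * P)"
    using c BB by (intro assoc_mult_mat[of _ m m _ m _ m]) auto
  also have "\<dots> = B * B" unfolding w(1) by (rule right_mult_one_mat[OF BB])
  finally show ?thesis .
qed

context pseudo_orthonormal_frame
begin

definition frame_vec :: "(nat \<Rightarrow> real) \<Rightarrow> real vec" where
  "frame_vec x = vec m (\<lambda>i. \<Sum>c<m. x c * p c i)"

text \<open>The factor \<open>\<eta> i\<close> raises an index of the Jacobi form, which gives the
  matrix of the Jacobi operator with respect to the frame.\<close>

definition frame_jacobi :: "(nat \<Rightarrow> real) \<Rightarrow> real mat" where
  "frame_jacobi x = mat m m (\<lambda>(i,j). \<eta> i * fr.J x i j)"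

lemma bilin_frame_vec: "bilin G (frame_vec x) (frame_vec x) = (\<Sum>k<m. \<eta> k * (x k)\<^sup>2)"
proof -
  let ?v = "vec m x"
  have X: "frame_vec x = P *\<^sub>v ?v"
    using P by (intro eq_vecI) (auto simp: frame_vec_def scalar_prod_def atLeast0LessThan mult.commute)
  have c: "P *\<^sub>v ?v \<in> carrier_vec m" "G *\<^sub>v (P *\<^sub>v ?v) \<in> carrier_vec m" "P\<^sup>T * G \<in> carrier_mat m m"
    using P G by (auto intro!: mult_mat_vec_carrier[of _ m m])
  have "bilin G (frame_vec x) (frame_vec x) = (P *\<^sub>v ?v) \<bullet> (G *\<^sub>v (P *\<^sub>v ?v))"
    unfolding X bilin_def using G P c
    by (auto simp: scalar_prod_def atLeast0LessThan sum_distrib_left mult.assoc intro!: sum.cong)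
  also have "\<dots> = ?v \<bullet> (P\<^sup>T *\<^sub>v (G *\<^sub>v (P *\<^sub>v ?v)))"
    using transpose_vec_mult_scalar[OF P, of ?v "G *\<^sub>v (P *\<^sub>v ?v)"] c
      comm_scalar_prod[OF c(1,2)] comm_scalar_prod[of ?v m "P\<^sup>T *\<^sub>v (G *\<^sub>v (P *\<^sub>v ?v))"]
    by (simp add: mult_mat_vec_carrier[OF P_transpose_carrier])
  also have "P\<^sup>T *\<^sub>v (G *\<^sub>v (P *\<^sub>v ?v)) = (P\<^sup>T * G * P) *\<^sub>v ?v"
    using P G c by (simp add: assoc_mult_mat_vec[of _ m m _ m])
  also have "\<dots> = vec m (\<lambda>k. \<eta> k * x k)"
    unfolding frame
    by (intro eq_vecI) (auto simp: scalar_prod_def if_distrib[of "\<lambda>y. y * _"] cong: if_cong)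
  finally show ?thesis
    by (simp add: scalar_prod_def atLeast0LessThan power2_eq_square mult_ac)
qed

lemma frame_J: "fr.J x a b = W4 (p a) (\<lambda>i. \<Sum>c<m. x c * p c i) (\<lambda>i. \<Sum>c<m. x c * p c i) (p b)"
  unfolding fr.J_def W4_linear_2 W4_linear_3 by (simp add: sum_distrib_left mult.assoc)

lemma jacobi_W_carrier: "jacobi_W m G R x \<in> carrier_mat m m"
  by (simp add: jacobi_W_def)

lemma frame_jacobi_carrier: "frame_jacobi x \<in> carrier_mat m m"
  by (simp add: frame_jacobi_def)

text \<open>\<open>P\<close> intertwines the operator in frame coordinates with the one in the given
  coordinates; the inverse metric enters as the signed sum over frame vectors.\<close>

lemma jacobi_W_frame: "jacobi_W m G R (frame_vec x) * P = P * frame_jacobi x"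
proof (rule eq_matI)
  let ?X = "\<lambda>i. \<Sum>c<m. x c * p c i" and ?J = "jacobi_W m G R (frame_vec x)"
  let ?V = "\<lambda>y w. W4 y ?X ?X w"
  fix k b assume "k < dim_row (P * frame_jacobi x)" "b < dim_col (P * frame_jacobi x)"
  then have kb: "k < m" "b < m" using P by (auto simp: frame_jacobi_def)
  have J: "?J $$ (k,e) = (\<Sum>c<m. ?V (basis e) (basis c) * ginv G $$ (c,k))" if "e < m" for e
    using that kb by (simp add: jacobi_W_def W4_basis_1_4 frame_vec_def)
  have "(?J * P) $$ (k,b) = (\<Sum>e<m. ?J $$ (k,e) * p b e)"
    using kb P by (simp add: jacobi_W_def scalar_prod_def atLeast0LessThan)
  also have "\<dots> = (\<Sum>e<m. \<Sum>c<m. p b e * ?V (basis e) (basis c) * ginv G $$ (c,k))"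
    by (intro sum.cong refl) (simp add: J sum_distrib_left sum_distrib_right mult_ac)
  also have "\<dots> = (\<Sum>c<m. \<Sum>e<m. p b e * ?V (basis e) (basis c) * ginv G $$ (c,k))"
    by (rule sum.swap)
  also have "\<dots> = (\<Sum>c<m. ?V (p b) (basis c) * ginv G $$ (c,k))"
    by (subst (2) W4_expand_1) (simp only: sum_distrib_right)
  also have "\<dots> = (\<Sum>c<m. \<Sum>f<m. P $$ (k,f) * (\<eta> f * (p f c * ?V (p b) (basis c))))"
    using kb by (intro sum.cong refl) (simp add: ginv_entry sum_distrib_left sum_distrib_right mult_ac)
  also have "\<dots> = (\<Sum>f<m. \<Sum>c<m. P $$ (k,f) * (\<eta> f * (p f c * ?V (p b) (basis c))))"
    by (rule sum.swap)
  also have "\<dots> = (\<Sum>f<m. P $$ (k,f) * (\<eta> f * ?V (p b) (p f)))"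
    by (subst (2) W4_expand_4) (simp only: sum_distrib_left)
  also have "\<dots> = (\<Sum>f<m. P $$ (k,f) * (\<eta> f * fr.J x f b))"
    unfolding frame_J[symmetric] by (subst fr.J_sym) (rule refl)
  also have "\<dots> = (P * frame_jacobi x) $$ (k,b)"
    using kb P by (simp add: frame_jacobi_def scalar_prod_def atLeast0LessThan)
  finally show "(?J * P) $$ (k,b) = (P * frame_jacobi x) $$ (k,b)" .
qed (use P in \<open>auto simp: jacobi_W_def frame_jacobi_def\<close>)

lemma similar_frame_jacobi:
  "similar_mat (map_mat complex_of_real (frame_jacobi x)) (map_mat complex_of_real (jacobi_W m G R (frame_vec x)))"
proof (rule similar_matI)
  let ?c = "map_mat complex_of_real" and ?J = "jacobi_W m G R (frame_vec x)"
  show "{?c (frame_jacobi x), ?c ?J, ?c Q, ?c P} \<subseteq> carrier_mat m m"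
    using P frame_jacobi_carrier jacobi_W_carrier by simp
  show "?c Q * ?c P = 1\<^sub>m m"
    unfolding of_real_hom.mat_hom_mult[OF Q_carrier P, symmetric] Q_P by (rule of_real_hom.mat_hom_one)
  show "?c P * ?c Q = 1\<^sub>m m"
    unfolding of_real_hom.mat_hom_mult[OF P Q_carrier, symmetric] P_Q by (rule of_real_hom.mat_hom_one)
  have "frame_jacobi x = Q * P * frame_jacobi x"
    unfolding Q_P by (rule left_mult_one_mat[OF frame_jacobi_carrier, symmetric])
  also have "\<dots> = Q * (P * frame_jacobi x)"
    by (rule assoc_mult_mat[OF Q_carrier P frame_jacobi_carrier])
  also have "\<dots> = Q * ?J * P"
    unfolding jacobi_W_frame[symmetric] by (rule assoc_mult_mat[OF Q_carrier jacobi_W_carrier P, symmetric])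
  finally have "?c (frame_jacobi x) = ?c (Q * ?J * P)" by simp
  also have "\<dots> = ?c Q * ?c ?J * ?c P"
    unfolding of_real_hom.mat_hom_mult[OF mult_carrier_square[OF Q_carrier jacobi_W_carrier] P]
      of_real_hom.mat_hom_mult[OF Q_carrier jacobi_W_carrier] by (rule refl)
  finally show "?c (frame_jacobi x) = ?c Q * ?c ?J * ?c P" .
qed

lemma jordan_nf_frame_jacobi:
  assumes "\<forall>x \<in> carrier_vec m. bilin G x x = 1 \<longrightarrow> jordan_nf (map_mat complex_of_real (jacobi_W m G R x)) n_as"
    and "(\<Sum>k<m. \<eta> k * (x k)\<^sup>2) = 1"
  shows "jordan_nf (map_mat complex_of_real (frame_jacobi x)) n_as"
proof -
  have "frame_vec x \<in> carrier_vec m" by (simp add: frame_vec_def)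
  then have "jordan_nf (map_mat complex_of_real (jacobi_W m G R (frame_vec x))) n_as"
    using assms bilin_frame_vec[of x] by simp
  then show ?thesis
    unfolding jordan_nf_def using similar_mat_trans[OF similar_frame_jacobi] by blast
qed

lemma weyl_vanishes_riemannian:
  assumes "conf_spacelike_jordan_osserman_at m G R" and "odd m" and eta: "\<And>i. i < m \<Longrightarrow> \<eta> i = 1"
  shows "weyl_vanishes_at m G R"
proof -
  obtain n_as where nf: "\<forall>x \<in> carrier_vec m. bilin G x x = 1 \<longrightarrow>
      jordan_nf (map_mat complex_of_real (jacobi_W m G R x)) n_as"
    using assms(1) by (auto simp: conf_spacelike_jordan_osserman_at_def)
  have Suc: "Suc (m - 1) = m" and le: "i \<le> m - 1 \<longleftrightarrow> i < m" and atM: "{..m - 1} = {..<m}" for i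
    using m3 by auto
  \<comment> \<open>In an orthonormal frame the unit vectors form the sphere of dimension
    \<open>m - 1\<close>, which is even for odd \<open>m\<close>. The root list comes from the
    Jordan form common to all unit vectors, and \<open>J\<close> is even in \<open>x\<close> because
    it is quadratic.\<close>
  interpret sph: isospectral_sphere "m - 1" fr.J "real_diagonal n_as"
  proof (unfold_locales, unfold Suc le atM)
    show "even (m - 1)" using \<open>odd m\<close> by simp
    show "distinct (real_diagonal n_as)" by (simp add: real_diagonal_def)
    show "continuous_on (unit_sphere (m - 1)) (\<lambda>x. fr.J x i j)" for i j
      by (rule fr.continuous_on_J) (rule continuous_on_subset[OF continuous_on_product_coordinates subset_UNIV])
    fix x assume x: "x \<in> unit_sphere (m - 1)"
    show "\<forall>i<m. \<forall>j<m. fr.J x i j = fr.J x j i" by (simp add: fr.J_sym)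
    show "(\<Sum>j<m. fr.J x i j * x j) = 0" for i by (rule fr.J_self)
    show "(\<Sum>i<m. fr.J x i i) = 0" using fr.J_trace[of x] by (simp add: eta)
    show "fr.J (\<lambda>i. - x i) = fr.J x" using fr.J_scale[of "-1" x] by (simp add: fun_eq_iff)
    have "(\<Sum>k<m. \<eta> k * (x k)\<^sup>2) = 1" using x unfolding unit_sphere_def atM by (simp add: eta)
    from jordan_nf_frame_jacobi[OF nf this]
    have "annihilates m (\<lambda>i j. frame_jacobi x $$ (i,j)) (real_diagonal n_as)"
      by (rule jordan_nf_annihilates[OF _ frame_jacobi_carrier]) (simp add: frame_jacobi_def eta fr.J_sym)
    moreover have "mvec m (\<lambda>i j. frame_jacobi x $$ (i,j)) = mvec m (fr.J x)"
      by (auto simp: mvec_def fun_eq_iff frame_jacobi_def eta)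
    ultimately show "annihilates m (fr.J x) (real_diagonal n_as)"
      by (simp add: annihilates_def)
  qed
  show ?thesis
    using sph.K_eq_0 by (intro weyl_vanishes_if_frame_vanishes fr.F_eq_0_riemannian) (auto simp: le)
qed

lemma weyl_vanishes_lorentzian:
  assumes "conf_spacelike_jordan_osserman_at m G R"
    and eta_0: "\<eta> 0 = -1" and eta_spatial: "\<And>i. 0 < i \<Longrightarrow> i < m \<Longrightarrow> \<eta> i = 1"
  shows "weyl_vanishes_at m G R"
proof -
  obtain n_as where nf: "\<forall>x \<in> carrier_vec m. bilin G x x = 1 \<longrightarrow>
      jordan_nf (map_mat complex_of_real (jacobi_W m G R x)) n_as"
    using assms(1) by (auto simp: conf_spacelike_jordan_osserman_at_def)
  let ?T = "jordan_matrix n_as" and ?c = "map_mat complex_of_real"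
  \<comment> \<open>The constant is the trace of the square of the common Jordan matrix. That trace
    is the complex image of a real number, so taking the real part loses nothing.\<close>
  have "fr.trace_J_sq x = Re (\<Sum>i<m. (?T * ?T) $$ (i,i))" if "(\<Sum>k<m. \<eta> k * (x k)\<^sup>2) = 1" for x
  proof -
    have "(\<Sum>i<m. (?c (frame_jacobi x) * ?c (frame_jacobi x)) $$ (i,i)) = (\<Sum>i<m. (?T * ?T) $$ (i,i))"
      using jordan_nf_frame_jacobi[OF nf that] frame_jacobi_carrier
      by (intro trace_square_similar) (auto simp: jordan_nf_def)
    moreover have "(?c (frame_jacobi x) * ?c (frame_jacobi x)) $$ (i,i) =
        of_real (\<Sum>j<m. \<eta> i * \<eta> j * (fr.J x i j)\<^sup>2)" if "i < m" for i
      using that fr.J_sym[of x i]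
      by (simp add: frame_jacobi_def scalar_prod_def atLeast0LessThan power2_eq_square mult_ac)
    ultimately have "complex_of_real (fr.trace_J_sq x) = (\<Sum>i<m. (?T * ?T) $$ (i,i))"
      by (simp add: fr.trace_J_sq_def)
    from arg_cong[OF this, of Re] show ?thesis by simp
  qed
  then show ?thesis
    using fr.F_eq_0_lorentzian[OF eta_0 eta_spatial] by (intro weyl_vanishes_if_frame_vanishes) blast
qed

end

section \<open>The converse direction and the conclusion for both signatures\<close>

lemma jordan_matrix_replicate_zero: "jordan_matrix (replicate m (1, 0)) = (0\<^sub>m m m :: complex mat)"
proof (induction m)
  case (Suc m)
  have "jordan_matrix (replicate (Suc m) (1, 0)) =
      four_block_mat (jordan_block 1 (0::complex)) (0\<^sub>m 1 m) (0\<^sub>m m 1) (jordan_matrix (replicate m (1, 0)))"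
    using Suc by (simp add: jordan_matrix_def Let_def)
  also have "\<dots> = 0\<^sub>m (Suc m) (Suc m)"
    unfolding Suc by (rule eq_matI) auto
  finally show ?case .
qed (auto simp: jordan_matrix_def)

text \<open>All Jacobi operators are then the zero matrix, whose Jordan form consists of
  \<open>m\<close> blocks of size 1 with eigenvalue 0.\<close>

lemma weyl_vanishes_imp_jordan_osserman:
  assumes "weyl_vanishes_at m G R"
  shows "conf_spacelike_jordan_osserman_at m G R"
proof -
  have J: "jacobi_W m G R x = 0\<^sub>m m m" for x
    using assms by (intro eq_matI) (auto simp: jacobi_W_def weyl_vanishes_at_def)
  let ?Z = "map_mat complex_of_real (0\<^sub>m m m)"
  have eq: "jordan_matrix (replicate m (1, 0)) = ?Z"
    unfolding jordan_matrix_replicate_zero by (rule eq_matI) auto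
  have "similar_mat ?Z ?Z" by (rule similar_mat_refl[of _ m]) simp
  then have "jordan_nf ?Z (replicate m (1, 0))"
    unfolding jordan_nf_def eq by auto
  then show ?thesis
    unfolding conf_spacelike_jordan_osserman_at_def J by (intro exI ballI impI)
qed

lemma conformally_flat_iff_riemannian:
  assumes "m \<ge> 3" "odd m" "alg_curv_tensor m R" "riemannian_metric m G"
  shows "conf_spacelike_jordan_osserman_at m G R \<longleftrightarrow> weyl_vanishes_at m G R"
proof -
  obtain P where G: "G \<in> carrier_mat m m" "G\<^sup>T = G" and P: "P \<in> carrier_mat m m" "P\<^sup>T * G * P = 1\<^sub>m m"
    using assms(4) by (auto simp: riemannian_metric_def)
  interpret pseudo_orthonormal_frame m G R P "\<lambda>_. 1"
    by unfold_locales (use assms G P in \<open>simp_all add: one_mat_def\<close>)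
  show ?thesis
    using weyl_vanishes_riemannian weyl_vanishes_imp_jordan_osserman assms(2) by blast
qed

lemma conformally_flat_iff_lorentzian:
  assumes "m \<ge> 3" "alg_curv_tensor m R" "lorentzian_metric m G"
  shows "conf_spacelike_jordan_osserman_at m G R \<longleftrightarrow> weyl_vanishes_at m G R"
proof -
  obtain P where G: "G \<in> carrier_mat m m" "G\<^sup>T = G"
    and P: "P \<in> carrier_mat m m" "P\<^sup>T * G * P = lorentz_diag m"
    using assms(3) by (auto simp: lorentzian_metric_def)
  interpret pseudo_orthonormal_frame m G R P "\<lambda>i. if i = 0 then -1 else 1"
    by unfold_locales (use assms G P in \<open>simp_all add: lorentz_diag_def\<close>)
  show ?thesis
    using weyl_vanishes_lorentzian weyl_vanishes_imp_jordan_osserman by auto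
qed


theorem theorem2p2:
  fixes M :: "'p set" and m :: nat
    and G :: "'p \<Rightarrow> real mat"
    and R :: "'p \<Rightarrow> nat \<Rightarrow> nat \<Rightarrow> nat \<Rightarrow> nat \<Rightarrow> real"
  assumes "m \<ge> 3"
    and "\<forall>P\<in>M. alg_curv_tensor m (R P)"
    and "((\<forall>P\<in>M. riemannian_metric m (G P)) \<and> odd m) \<or> (\<forall>P\<in>M. lorentzian_metric m (G P))"
  shows "(\<forall>P\<in>M. conf_spacelike_jordan_osserman_at m (G P) (R P)) \<longleftrightarrow>
         (\<forall>P\<in>M. weyl_vanishes_at m (G P) (R P))"
  using assms(3)
proof
  assume "(\<forall>P\<in>M. riemannian_metric m (G P)) \<and> odd m"
  then show ?thesis
    using assms(1,2) by (simp add: conformally_flat_iff_riemannian)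
next
  assume "\<forall>P\<in>M. lorentzian_metric m (G P)"
  then show ?thesis
    using assms(1,2) by (simp add: conformally_flat_iff_lorentzian)
qed

end
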